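(* Let $0<\lambda<1$, $a\in\mathbb{C}$, and $F:\mathbb{C}^2\to\mathbb{C}^2$, $F(z,w)=(\lambda z-z^2,\ w-w^2+azw^3)$, and let $\Omega$ be the attracting basin of $F$ at $(0,0)$. Then for every sufficiently small $\epsilon>0$ the following holds. Let $S=\bigcup_{k\ge 0}F^{-k}(\{(\epsilon,\epsilon)\})$ be the set of preimages of $(\epsilon,\epsilon)$ under $F$. For any connected component $\Omega_\alpha$ of $\Omega$, set $S_\alpha:=S\cap\Omega_\alpha$. Then for every constant $C>0$ there exists a point $p_\alpha\in\Omega_\alpha$ such that for every $q\in S_\alpha$ the Kobayashi distance satisfies $d_{\Omega_\alpha}(p_\alpha,q)\ge C$.
   Context: The attracting basin $\Omega$ of $F$ at $(0,0)$ is the set of points of $\mathbb{C}^2$ having an open neighborhood on which the iterates $F^n$ converge uniformly to the constant $(0,0)$; it is an open set. $d_{\Omega_\alpha}$ denotes the Kobayashi (pseudo)distance of the domain $\Omega_\alpha$. *)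

theory Defs
  imports "HOL-Complex_Analysis.Complex_Analysis"
begin

definition F_map :: "real \<Rightarrow> complex \<Rightarrow> complex \<times> complex \<Rightarrow> complex \<times> complex" where
  "F_map lam a = (\<lambda>(z, w). (of_real lam * z - z ^ 2, w - w ^ 2 + a * z * w ^ 3))"

definition attracting_basin :: "('a::metric_space \<Rightarrow> 'a) \<Rightarrow> 'a \<Rightarrow> 'a set" where
  "attracting_basin f c =
     {x. \<exists>U. open U \<and> x \<in> U \<and> uniform_limit U (\<lambda>n. f ^^ n) (\<lambda>_. c) sequentially}"

definition preimages :: "('a \<Rightarrow> 'a) \<Rightarrow> 'a \<Rightarrow> 'a set" where
  "preimages f c = (\<Union>k. (f ^^ k) -` {c})"

text \<open>The Poincare distance of the unit disc, normalised so that the infinitesimal metric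
  at the origin is the Euclidean one (curvature -4).\<close>

definition poincare_dist :: "complex \<Rightarrow> complex \<Rightarrow> real" where
  "poincare_dist u v = artanh (norm ((u - v) / (1 - cnj v * u)))"

definition holomorphic_disc :: "(complex \<times> complex) set \<Rightarrow> (complex \<Rightarrow> complex \<times> complex) \<Rightarrow> bool" where
  "holomorphic_disc D f \<longleftrightarrow>
     (\<lambda>t. fst (f t)) holomorphic_on ball 0 1 \<and>
     (\<lambda>t. snd (f t)) holomorphic_on ball 0 1 \<and>
     f ` ball 0 1 \<subseteq> D"

text \<open>Lengths of chains of holomorphic discs in \<open>D\<close> from \<open>p\<close> to \<open>q\<close>: the points
  \<open>x 0 = p, x 1, \<dots>, x n = q\<close> are successively joined by discs \<open>f i\<close> with
  \<open>f i (u i) = x i\<close> and \<open>f i (v i) = x (Suc i)\<close>.\<close>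

definition kobayashi_chain_lengths ::
    "(complex \<times> complex) set \<Rightarrow> complex \<times> complex \<Rightarrow> complex \<times> complex \<Rightarrow> real set" where
  "kobayashi_chain_lengths D p q =
     {L. \<exists>(n::nat) x u v f. n \<ge> 1 \<and> x 0 = p \<and> x n = q \<and>
        (\<forall>i<n. u i \<in> ball 0 1 \<and> v i \<in> ball 0 1 \<and> holomorphic_disc D (f i) \<and>
               f i (u i) = x i \<and> f i (v i) = x (Suc i)) \<and>
        L = (\<Sum>i<n. poincare_dist (u i) (v i))}"

text \<open>Meant for \<open>p, q\<close> in a domain (connected open set) \<open>D\<close>: there, a chain of discs joining
  \<open>p\<close> to \<open>q\<close> always exists, so that the infimum is over a nonempty set of nonnegative reals.\<close>

definition kobayashi_dist ::
    "(complex \<times> complex) set \<Rightarrow> complex \<times> complex \<Rightarrow> complex \<times> complex \<Rightarrow> real" where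
  "kobayashi_dist D p q = Inf (kobayashi_chain_lengths D p q)"

end

theory Submission
  imports Defs "HOL-Real_Asymp.Real_Asymp"
    "HOL-Computational_Algebra.Fundamental_Theorem_Algebra"
begin

text \<open>
  Write \<open>F = F_map lam a\<close>, \<open>E = (\<epsilon>, \<epsilon>)\<close>, and \<open>\<Omega>\<close> for the basin.  Suppose \<open>q\<close> satisfies
  \<open>F\<^sup>k q = E\<close> and some chain of discs of length less than \<open>C\<close> joins \<open>p\<close> to \<open>q\<close>.  Pushing the
  chain forward by \<open>F\<^sup>m\<^sup>+\<^sup>k\<close> gives a chain from \<open>F\<^sup>m\<^sup>+\<^sup>k p\<close> to \<open>F\<^sup>m E\<close>, a point that depends on
  \<open>m\<close> but not on \<open>k\<close>.  A chain of bounded length ending at a fixed point off the line \<open>w = 0\<close>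
  cannot start arbitrarily close to that line.  So it suffices to choose \<open>p\<close> whose forward orbit,
  from some time on, is closer to \<open>w = 0\<close> than this allows, and such \<open>p\<close> exist deep in the
  parabolic petal: there \<open>Re (1/w)\<close> increases along orbits.

  The quantitative tool is a Landau type estimate.  If \<open>g\<close> is holomorphic on the disc and omits
  \<open>0\<close> and \<open>1\<close>, then \<open>arsinh (ln \<bar>g\<bar>)\<close> is Lipschitz for the Poincare distance with a universal
  constant (\<open>loglog_segment_bound\<close>).  Summed along a chain, this controls a function omitting
  \<open>0\<close> and \<open>1\<close> along the chain by its total length, whatever the number of discs.

  Where do such functions on \<open>\<Omega>\<close> come from?  The coordinate \<open>w\<close> never vanishes on an orbit that
  starts in \<open>\<Omega>\<close>: the fibre maps are tangent to the identity along \<open>w = 0\<close>, so their iterates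
  cannot be uniformly small near \<open>0\<close> (\<open>F_orbit_snd_nonzero_on_basin\<close>).  Applied to the next point
  of the orbit, this says that \<open>1 - w + a z w\<^sup>2\<close> does not vanish either.  For \<open>4 \<bar>a z\<bar> < 1\<close> one
  root \<open>w\<^sub>1 z\<close> of this quadratic is holomorphic in \<open>z\<close>, and then \<open>w / w\<^sub>1 z\<close> omits \<open>0\<close> and \<open>1\<close>;
  this is the function \<open>straighten\<close>.

  The smallness of \<open>z\<close> is bought by iterating.  The basin of \<open>lam z - z\<^sup>2\<close> omits every point \<open>b\<close>
  of its complement together with the repelling fixed point \<open>lam - 1\<close> and its preimage \<open>1\<close>, so the
  same estimate shows that the \<open>z\<close>-coordinates along a chain of length at most \<open>C\<close> ending over
  \<open>\<epsilon>\<close> stay in a compact subset of that basin (\<open>horizontal_confinement\<close>).  A number \<open>m\<close> of further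
  iterates, depending on \<open>C\<close> and \<open>\<epsilon>\<close> but not on the chain, makes all of them small, and \<open>vertical_bound\<close> follows.

  Finally, \<open>p\<close> has to lie in the given component \<open>D\<close>.  If \<open>D\<close> contains \<open>q0\<close> with
  \<open>F\<^sup>k\<^sup>0 q0 = E\<close>, then on the fibre through \<open>q0\<close> the map \<open>F\<^sup>k\<^sup>0\<close> is a nonconstant polynomial, hence
  proper, and the component of the preimage of the petal that contains \<open>q0\<close> is mapped onto the whole
  petal (\<open>component_meets_petal_fibre\<close>).  If \<open>D\<close> contains no preimage of \<open>E\<close>, every \<open>p\<close> will do.
\<close>

section \<open>Functions on the disc that omit two values\<close>

text \<open>The bound that Schottky's theorem gives on \<open>\<bar>z\<bar> \<le> 1/2\<close> for functions with \<open>\<bar>f 0\<bar> \<le> 1\<close>.\<close>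

definition schottky_const :: real where
  "schottky_const = exp (pi * exp (pi * 16))"

lemma schottky_const_pos: "schottky_const > 0"
  by (simp add: schottky_const_def)

text \<open>Schottky's theorem bounds \<open>f\<close> near \<open>0\<close>, and the Cauchy estimate turns this into a bound for the
  derivative.\<close>

lemma landau_deriv_bound:
  assumes hol: "f holomorphic_on ball 0 1"
    and omit: "\<And>z. z \<in> ball 0 1 \<Longrightarrow> f z \<noteq> 0 \<and> f z \<noteq> 1"
    and f0: "norm (f 0) \<le> 1"
  shows "norm (deriv f 0) \<le> 4 * schottky_const"
proof -
  define g where "g = (\<lambda>z. f (z / 2))"
  have holg: "g holomorphic_on cball 0 1"
    unfolding g_def
    by (rule holomorphic_on_compose_gen[OF _ hol, unfolded o_def])
       (auto intro!: holomorphic_intros simp: norm_divide)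
  have bound: "norm (f z) \<le> schottky_const" if "norm z \<le> 1/4" for z
  proof -
    have "norm (g (2 * z)) \<le> exp (pi * exp (pi * (2 + 2 * 1 + 12 * (1/2) / (1 - 1/2))))"
      by (rule Schottky[OF holg]) (use f0 omit that in \<open>auto simp: g_def norm_divide norm_mult\<close>)
    then show ?thesis by (simp add: g_def schottky_const_def)
  qed
  have "norm ((deriv ^^ 1) f 0) \<le> fact 1 * schottky_const / (1/4) ^ 1"
  proof (rule Cauchy_inequality)
    show "f holomorphic_on ball 0 (1/4)" using hol by (rule holomorphic_on_subset) auto
    show "continuous_on (cball 0 (1/4)) f"
      using hol by (intro holomorphic_on_imp_continuous_on holomorphic_on_subset[OF hol]) auto
  qed (use bound in auto)
  then show ?thesis by simp
qed

text \<open>The point is that the bound grows only linearly in \<open>Re (h t)\<close>, which a direct application of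
  Schottky's theorem to \<open>exp \<circ> h\<close> would not give.  Since \<open>h / (2 \<pi> \<i>)\<close> omits all integers, one may
  translate it by an integer and then divide by a positive integer \<open>N\<close> comparable to its size; the
  quotient still omits \<open>0\<close> and \<open>1\<close> and has modulus at most \<open>1\<close> at the centre.\<close>

lemma deriv_bound_exp_ne_1:
  assumes hol: "h holomorphic_on ball t r" and "r > 0"
    and omit: "\<And>z. z \<in> ball t r \<Longrightarrow> exp (h z) \<noteq> 1"
  shows "norm (deriv h t) * r \<le> 16 * pi * schottky_const * (1 + \<bar>Re (h t)\<bar>)"
proof -
  define c0 where "c0 = h t / (2 * pi * \<i>)"
  \<comment> \<open>Translating by \<open>n\<close> leaves only the imaginary part of \<open>c0\<close>, that is \<open>Re (h t)\<close>, to be large.\<close>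
  define n where "n = \<lfloor>Re c0\<rfloor>"
  define c where "c = (\<lambda>\<zeta>. h (t + of_real r * \<zeta>) / (2 * pi * \<i>) - of_int n)"
  have inball: "t + of_real r * \<zeta> \<in> ball t r" if "norm \<zeta> < 1" for \<zeta>
    using that \<open>r > 0\<close> by (simp add: dist_norm norm_mult)
  have omitc: "c \<zeta> \<noteq> of_int m" if "norm \<zeta> < 1" for \<zeta> m
  proof
    assume "c \<zeta> = of_int m"
    then have "h (t + of_real r * \<zeta>) = of_int (2 * (m + n)) * pi * \<i>"
      by (simp add: c_def field_simps)
    then have "exp (h (t + of_real r * \<zeta>)) = 1"
      unfolding exp_eq_1 by (auto intro!: exI[of _ "m + n"])
    with omit[OF inball[OF that]] show False by simp
  qed
  have c0eq: "c 0 = c0 - of_int n" by (simp add: c_def c0_def)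
  have Im0: "\<bar>Im c0\<bar> = \<bar>Re (h t)\<bar> / (2 * pi)"
    by (simp add: c0_def Im_divide power2_eq_square)
  have "\<bar>Re (c 0)\<bar> \<le> 1" unfolding c0eq n_def by (simp; linarith)
  then have nc: "norm (c 0) \<le> 1 + \<bar>Re (h t)\<bar> / (2 * pi)"
    using cmod_le[of "c 0"] Im0 by (simp add: c0eq)
  define N where "N = nat \<lceil>norm (c 0)\<rceil>"
  have c00: "c 0 \<noteq> 0" using omitc[of 0 0] by simp
  then have "0 < norm (c 0)" by simp
  then have N: "N > 0" "norm (c 0) \<le> real N" "real N \<le> norm (c 0) + 1"
    unfolding N_def by linarith+
  define d where "d = (\<lambda>\<zeta>. c \<zeta> / of_nat N)"
  have hol_c: "c holomorphic_on ball 0 1"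
    unfolding c_def
    by (intro holomorphic_intros holomorphic_on_compose_gen[OF _ hol, unfolded o_def])
       (use inball in auto)
  have "norm (deriv d 0) \<le> 4 * schottky_const"
  proof (rule landau_deriv_bound)
    show "d holomorphic_on ball 0 1"
      unfolding d_def using N by (intro holomorphic_intros hol_c) auto
    show "d z \<noteq> 0 \<and> d z \<noteq> 1" if "z \<in> ball 0 1" for z
      using omitc[of z 0] omitc[of z "int N"] that N by (auto simp: d_def)
    show "norm (d 0) \<le> 1" using N by (simp add: d_def norm_divide)
  qed
  moreover have "(d has_field_derivative (deriv h t * of_real r / (2 * pi * \<i>) / of_nat N)) (at 0)"
  proof -
    have "(h has_field_derivative deriv h t) (at (t + of_real r * 0))"
      using holomorphic_derivI[OF hol, of t] \<open>r > 0\<close> by simp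
    moreover have "((\<lambda>\<zeta>. t + of_real r * \<zeta>) has_field_derivative of_real r) (at 0)"
      by (auto intro!: derivative_eq_intros)
    ultimately have "((\<lambda>\<zeta>. h (t + of_real r * \<zeta>)) has_field_derivative deriv h t * of_real r) (at 0)"
      by (rule DERIV_chain2)
    then show ?thesis
      unfolding d_def c_def using N by (auto intro!: derivative_eq_intros simp: field_simps)
  qed
  ultimately have "norm (deriv h t * of_real r / (2 * pi * \<i>) / of_nat N) \<le> 4 * schottky_const"
    by (metis DERIV_imp_deriv)
  then have "norm (deriv h t) * r \<le> 4 * schottky_const * (2 * pi * real N)"
    using N \<open>r > 0\<close> by (simp add: norm_divide norm_mult field_simps)
  also have "\<dots> \<le> 4 * schottky_const * (2 * pi * (2 * (1 + \<bar>Re (h t)\<bar>)))"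
  proof -
    have "\<bar>Re (h t)\<bar> * 1 \<le> \<bar>Re (h t)\<bar> * (2 * pi)"
      using pi_gt3 by (intro mult_left_mono) auto
    then have "\<bar>Re (h t)\<bar> / (2 * pi) \<le> \<bar>Re (h t)\<bar>"
      by (simp add: divide_le_eq)
    then have "real N \<le> 2 * (1 + \<bar>Re (h t)\<bar>)" using N nc abs_ge_zero[of "Re (h t)"] by argo
    then show ?thesis using schottky_const_pos by (intro mult_left_mono) auto
  qed
  finally show ?thesis by (simp add: mult_ac)
qed

lemma one_plus_abs_le_sqrt: "1 + \<bar>x\<bar> \<le> 2 * sqrt (x\<^sup>2 + 1)" for x :: real
proof -
  have "\<bar>x\<bar> \<le> sqrt (x\<^sup>2 + 1)" by (rule real_le_rsqrt) simp
  moreover have "1 \<le> sqrt (x\<^sup>2 + 1)" by simp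
  ultimately show ?thesis by linarith
qed

text \<open>The Lipschitz constant of \<open>loglog \<circ> g\<close>, up to a factor \<open>2\<close>, for functions \<open>g\<close> omitting \<open>0\<close>
  and \<open>1\<close>.\<close>

definition hyp_const :: real where
  "hyp_const = 32 * pi * schottky_const"

lemma hyp_const_pos: "hyp_const > 0"
  by (simp add: hyp_const_def schottky_const_pos)

text \<open>As \<open>y\<close> tends to \<open>0\<close> or \<open>\<infinity>\<close> this is, up to sign and a bounded error, \<open>ln \<bar>ln \<bar>y\<bar>\<bar>\<close>, which is the
  order of growth of the hyperbolic distance in the plane without \<open>0\<close> and \<open>1\<close>.  Using \<open>arsinh\<close> keeps it
  differentiable where \<open>\<bar>y\<bar> = 1\<close>.\<close>

definition loglog :: "complex \<Rightarrow> real" where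
  "loglog y = arsinh (ln (norm y))"

text \<open>With a holomorphic logarithm \<open>h\<close> of \<open>g\<close> one has \<open>loglog \<circ> g = arsinh \<circ> Re \<circ> h\<close>, and the factor
  \<open>1 + \<bar>Re h\<bar>\<close> in the bound for \<open>h'\<close> is absorbed by the derivative of \<open>arsinh\<close>.\<close>

lemma loglog_radial_derivative:
  fixes x :: real and v :: complex
  assumes hol: "g holomorphic_on ball (of_real x * v) r" and "r > 0"
    and omit: "\<And>z. z \<in> ball (of_real x * v) r \<Longrightarrow> g z \<noteq> 0 \<and> g z \<noteq> 1"
  shows "\<exists>D. ((\<lambda>s. loglog (g (of_real s * v))) has_real_derivative D) (at x) \<and>
             \<bar>D\<bar> \<le> hyp_const * norm v / r"
proof -
  define t where "t = of_real x * v"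
  have tb: "t \<in> ball t r" using \<open>r > 0\<close> by simp
  obtain h where h: "h holomorphic_on ball t r" "\<And>z. z \<in> ball t r \<Longrightarrow> exp (h z) = g z"
    using holomorphic_logarithm_exists[OF _ _ hol[folded t_def] _ tb] omit t_def by auto
  have hb: "norm (deriv h t) * r \<le> hyp_const / 2 * (1 + \<bar>Re (h t)\<bar>)"
    using deriv_bound_exp_ne_1[OF h(1) \<open>r > 0\<close>] h(2) omit by (simp add: hyp_const_def t_def mult_ac)
  have "(h has_field_derivative deriv h t) (at (of_real x * v))"
    using holomorphic_derivI[OF h(1) _ tb] t_def by auto
  then have "((\<lambda>s. h (of_real s * v)) has_vector_derivative (deriv h t * v)) (at x)"
  proof -
    assume h': "(h has_field_derivative deriv h t) (at (of_real x * v))"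
    have "((\<lambda>s. of_real s * v) has_vector_derivative v) (at x)"
      unfolding has_vector_derivative_def
      by (auto intro!: derivative_eq_intros simp: scaleR_conv_of_real)
    from field_vector_diff_chain_at[OF this h'] show ?thesis by (simp add: o_def mult_ac)
  qed
  then have Re1: "((\<lambda>s. Re (h (of_real s * v))) has_real_derivative Re (deriv h t * v)) (at x)"
    by (rule has_field_derivative_Re)
  define D where "D = Re (deriv h t * v) / sqrt ((Re (h t))\<^sup>2 + 1)"
  have Re2: "((\<lambda>s. arsinh (Re (h (of_real s * v)))) has_real_derivative D) (at x)"
    using DERIV_chain2[OF arsinh_real_has_field_derivative Re1] unfolding D_def t_def
    by simp
  have "open ((\<lambda>s::real. of_real s * v) -` ball t r)"
    by (intro open_vimage continuous_intros) auto
  then have ev: "\<forall>\<^sub>F s in nhds x. of_real s * v \<in> ball t r"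
    using eventually_nhds_in_open[of _ x] tb by (fastforce simp: t_def)
  have eq: "loglog (g w) = arsinh (Re (h w))" if "w \<in> ball t r" for w
    using h(2)[OF that, symmetric] by (simp add: loglog_def norm_exp_eq_Re)
  have "((\<lambda>s. loglog (g (of_real s * v))) has_real_derivative D) (at x)"
    using Re2 by (rule DERIV_cong_ev[THEN iffD1, OF refl _ refl, rotated])
      (use ev eq in \<open>auto elim!: eventually_mono\<close>)
  moreover have "\<bar>D\<bar> \<le> hyp_const * norm v / r"
  proof -
    have "\<bar>Re (deriv h t * v)\<bar> * r \<le> norm (deriv h t) * r * norm v"
      using abs_Re_le_cmod[of "deriv h t * v"] \<open>r > 0\<close> by (simp add: norm_mult mult_ac)
    also have "\<dots> \<le> hyp_const / 2 * (1 + \<bar>Re (h t)\<bar>) * norm v"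
      by (rule mult_right_mono[OF hb]) simp
    also have "\<dots> \<le> hyp_const / 2 * (2 * sqrt ((Re (h t))\<^sup>2 + 1)) * norm v"
      using one_plus_abs_le_sqrt hyp_const_pos by (intro mult_right_mono mult_left_mono) auto
    finally have "\<bar>Re (deriv h t * v)\<bar> * r \<le> hyp_const * norm v * sqrt ((Re (h t))\<^sup>2 + 1)"
      by (simp add: mult_ac)
    moreover have "sqrt ((Re (h t))\<^sup>2 + 1) > 0" by (simp add: add_nonneg_pos)
    ultimately show ?thesis using \<open>r > 0\<close> unfolding D_def
      by (simp add: abs_divide field_simps)
  qed
  ultimately show ?thesis by blast
qed

text \<open>Integration of the radial estimate.  The function need only be defined, and omit \<open>0\<close> and \<open>1\<close>, on
  discs around the points of the segment whose radii are a fixed fraction \<open>c\<close> of the distance to the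
  unit circle.  This matters later: a function that omits two values only where a coordinate is small
  is controlled on such discs but not on the whole unit disc.\<close>

lemma loglog_segment_bound:
  assumes v: "norm v < 1" and c: "0 < c" "c \<le> 1"
    and hol: "\<And>x. 0 \<le> x \<Longrightarrow> x \<le> 1 \<Longrightarrow>
        g holomorphic_on ball (of_real x * v) (c * (1 - x * norm v))"
    and omit: "\<And>x z. 0 \<le> x \<Longrightarrow> x \<le> 1 \<Longrightarrow>
        z \<in> ball (of_real x * v) (c * (1 - x * norm v)) \<Longrightarrow> g z \<noteq> 0 \<and> g z \<noteq> 1"
  shows "\<bar>loglog (g v) - loglog (g 0)\<bar> \<le> 2 * hyp_const / c * artanh (norm v)"
proof -
  define G where "G = (\<lambda>s. loglog (g (of_real s * v)))"
  define H where "H = (\<lambda>s. - (hyp_const / c * ln (1 - s * norm v)))"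
  have pos: "1 - x * norm v > 0" if "0 \<le> x" "x \<le> 1" for x
    using mult_right_mono[of x 1 "norm v"] that v by auto
  have dG: "\<exists>D. (G has_real_derivative D) (at x) \<and> \<bar>D\<bar> \<le> hyp_const * norm v / (c * (1 - x * norm v))"
    if "0 \<le> x" "x \<le> 1" for x
    unfolding G_def
    by (rule loglog_radial_derivative) (use hol omit that pos c in auto)
  have dH: "(H has_real_derivative hyp_const * norm v / (c * (1 - x * norm v))) (at x)"
    if "0 \<le> x" "x \<le> 1" for x
    unfolding H_def using pos[OF that] c
    by (auto intro!: derivative_eq_intros simp: divide_simps)
  have "H 0 - G 0 \<le> H 1 - G 1"
  proof (rule DERIV_nonneg_imp_nondecreasing[of 0 1 "\<lambda>x. H x - G x"])
    fix x :: real assume x: "0 \<le> x" "x \<le> 1"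
    obtain D where D: "(G has_real_derivative D) (at x)" "\<bar>D\<bar> \<le> hyp_const * norm v / (c * (1 - x * norm v))"
      using dG[OF x] by blast
    show "\<exists>y. ((\<lambda>x. H x - G x) has_real_derivative y) (at x) \<and> 0 \<le> y"
      by (rule exI, rule conjI, rule DERIV_diff[OF dH[OF x] D(1)]) (use D(2) in auto)
  qed auto
  moreover have "H 0 + G 0 \<le> H 1 + G 1"
  proof (rule DERIV_nonneg_imp_nondecreasing[of 0 1 "\<lambda>x. H x + G x"])
    fix x :: real assume x: "0 \<le> x" "x \<le> 1"
    obtain D where D: "(G has_real_derivative D) (at x)" "\<bar>D\<bar> \<le> hyp_const * norm v / (c * (1 - x * norm v))"
      using dG[OF x] by blast
    show "\<exists>y. ((\<lambda>x. H x + G x) has_real_derivative y) (at x) \<and> 0 \<le> y"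
      by (rule exI, rule conjI, rule DERIV_add[OF dH[OF x] D(1)]) (use D(2) in auto)
  qed auto
  ultimately have "\<bar>G 1 - G 0\<bar> \<le> H 1 - H 0" by linarith
  also have "H 1 - H 0 = hyp_const / c * (- ln (1 - norm v))" by (simp add: H_def)
  also have "\<dots> \<le> hyp_const / c * (2 * artanh (norm v))"
  proof (rule mult_left_mono)
    have "2 * artanh (norm v) = ln (1 + norm v) - ln (1 - norm v)"
      unfolding artanh_def using v ln_div[of "1 + norm v" "1 - norm v"] norm_ge_zero[of v] by simp
    also have "\<dots> \<ge> 0 - ln (1 - norm v)" by (intro diff_right_mono) simp
    finally show "- ln (1 - norm v) \<le> 2 * artanh (norm v)" by simp
    show "0 \<le> hyp_const / c" using c hyp_const_pos by simp
  qed
  finally show ?thesis by (simp add: G_def mult_ac)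
qed

lemma loglog_disc_bound:
  assumes hol: "f holomorphic_on ball 0 1" and omit: "\<And>t. t \<in> ball 0 1 \<Longrightarrow> f t \<noteq> 0 \<and> f t \<noteq> 1"
    and v: "norm v < 1"
  shows "\<bar>loglog (f v) - loglog (f 0)\<bar> \<le> 2 * hyp_const * artanh (norm v)"
proof -
  have sub: "ball (of_real x * v) (1 * (1 - x * norm v)) \<subseteq> ball 0 1" if "0 \<le> x" for x :: real
    using that by (intro ball_subset_ball_iff[THEN iffD2]) (auto simp: norm_mult dist_norm)
  have "\<bar>loglog (f v) - loglog (f 0)\<bar> \<le> 2 * hyp_const / 1 * artanh (norm v)"
  proof (rule loglog_segment_bound[OF v])
    fix x :: real assume x: "0 \<le> x"
    show "f holomorphic_on ball (of_real x * v) (1 * (1 - x * norm v))"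
      by (rule holomorphic_on_subset[OF hol sub[OF x]])
    show "f z \<noteq> 0 \<and> f z \<noteq> 1" if "z \<in> ball (of_real x * v) (1 * (1 - x * norm v))" for z
      using sub[OF x] that omit by blast
  qed auto
  then show ?thesis by simp
qed

lemma loglog_abs_le:
  assumes "norm y \<le> B" "1 \<le> B * norm y" "y \<noteq> 0"
  shows "\<bar>loglog y\<bar> \<le> arsinh (ln B)"
proof -
  have ny: "norm y > 0" using assms by simp
  then have B: "B > 0" using assms by linarith
  have "ln (norm y) \<le> ln B" using assms ny B by simp
  moreover have "- ln B \<le> ln (norm y)"
    using assms ny B ln_mult[of B "norm y"] ln_ge_zero[of "B * norm y"] by simp
  ultimately show ?thesis
    using sinh_real_le_iff[of "arsinh (ln (norm y))" "arsinh (ln B)"]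
      sinh_real_le_iff[of "- arsinh (ln B)" "arsinh (ln (norm y))"]
    by (simp add: loglog_def abs_le_iff)
qed

lemma norm_ge_of_loglog:
  assumes "\<bar>loglog y\<bar> \<le> M" "y \<noteq> 0"
  shows "norm y \<ge> exp (- sinh M)"
proof -
  have "sinh (- M) \<le> sinh (arsinh (ln (norm y)))"
    using assms(1) unfolding sinh_real_le_iff loglog_def by linarith
  then have "- sinh M \<le> ln (norm y)" by simp
  then show ?thesis using assms(2) by (simp add: ln_ge_iff)
qed

text \<open>Uniformity in \<open>b\<close>: the quotient stays away from \<open>0\<close> and \<open>\<infinity>\<close> for all \<open>b\<close> at distance at least
  \<open>d\<close> from \<open>\<epsilon>\<close>, however large \<open>b\<close> is.\<close>

lemma loglog_ratio_bound:
  fixes \<epsilon> b e :: complex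
  assumes d: "d > 0" "d \<le> norm (\<epsilon> - b)" and e: "1 / 2 \<le> norm (e - b)" "norm e \<le> 1"
  shows "\<bar>loglog ((\<epsilon> - b) / (e - b))\<bar> \<le> arsinh (ln (1 + (norm \<epsilon> + 1) * (2 + 1 / d)))"
    (is "_ \<le> arsinh (ln ?P)")
proof (rule loglog_abs_le)
  have ne: "norm (e - \<epsilon>) \<le> norm \<epsilon> + 1"
    using norm_triangle_ineq4[of e \<epsilon>] e(2) by simp
  have P: "?P = 1 + (norm \<epsilon> + 1) * 2 + (norm \<epsilon> + 1) / d"
    by (simp add: algebra_simps add_divide_distrib)
  have pos: "norm (e - b) > 0" "norm (\<epsilon> - b) > 0" using d e by auto
  have "norm (\<epsilon> - b) \<le> norm (e - b) + norm (e - \<epsilon>)"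
    using norm_triangle_ineq4[of "e - b" "e - \<epsilon>"] by simp
  also have "\<dots> \<le> norm (e - b) + (norm \<epsilon> + 1) * (2 * norm (e - b))"
    using ne e(1) mult_left_mono[of 1 "2 * norm (e - b)" "norm \<epsilon> + 1"] by simp
  also have "\<dots> = (1 + (norm \<epsilon> + 1) * 2) * norm (e - b)" by (simp add: algebra_simps)
  also have "\<dots> \<le> ?P * norm (e - b)"
    using d(1) unfolding P by (intro mult_right_mono) auto
  finally show "norm ((\<epsilon> - b) / (e - b)) \<le> ?P"
    using pos by (simp add: norm_divide divide_le_eq)
  have "norm (e - b) \<le> norm (\<epsilon> - b) + norm (e - \<epsilon>)"
    using norm_triangle_ineq[of "\<epsilon> - b" "e - \<epsilon>"] by simp
  also have "\<dots> \<le> norm (\<epsilon> - b) + (norm \<epsilon> + 1) * (norm (\<epsilon> - b) / d)"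
    using ne d mult_left_mono[of 1 "norm (\<epsilon> - b) / d" "norm \<epsilon> + 1"] by simp
  also have "\<dots> = (1 + (norm \<epsilon> + 1) / d) * norm (\<epsilon> - b)" by (simp add: algebra_simps)
  also have "\<dots> \<le> ?P * norm (\<epsilon> - b)"
    unfolding P by (intro mult_right_mono) auto
  finally show "1 \<le> ?P * norm ((\<epsilon> - b) / (e - b))"
    using pos by (simp add: norm_divide le_divide_eq)
  show "(\<epsilon> - b) / (e - b) \<noteq> 0" using pos by auto
qed

section \<open>Chains of holomorphic discs\<close>

lemma artanh_nonneg: "0 \<le> x \<Longrightarrow> x < 1 \<Longrightarrow> 0 \<le> artanh (x::real)"
  by (simp add: artanh_def)

lemma artanh_mono:
  assumes "0 \<le> x" "x \<le> y" "y < (1::real)"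
  shows "artanh x \<le> artanh y"
proof -
  have "(1 + x) / (1 - x) \<le> (1 + y) / (1 - y)"
    using assms by (intro frac_le) auto
  moreover have "0 < (1 + x) / (1 - x)" using assms by auto
  ultimately show ?thesis by (simp add: artanh_def)
qed

text \<open>A point halfway to the unit circle is only a bounded Poincare distance further out.\<close>

lemma artanh_half_step:
  assumes "0 \<le> x" "x < 1" "0 \<le> y" "y \<le> (1 + x) / 2"
  shows "artanh y \<le> artanh x + ln (2::real)"
proof -
  have "artanh y \<le> artanh ((1 + x) / 2)" using assms by (intro artanh_mono) auto
  also have "\<dots> = ln ((3 + x) / (1 - x)) / 2"
    using assms by (simp add: artanh_def field_simps)
  also have "\<dots> \<le> ln (4 * ((1 + x) / (1 - x))) / 2"
    using assms by (simp add: divide_simps)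
  also have "ln (4 * ((1 + x) / (1 - x))) = 2 * ln 2 + ln ((1 + x) / (1 - x))"
    using assms ln_realpow[of 2 2] by (subst ln_mult) auto
  finally show ?thesis by (simp add: artanh_def)
qed

lemma poincare_dist_eq_Moebius:
  "poincare_dist u v = artanh (norm (Moebius_function 0 u v))"
proof -
  have "norm (1 - cnj v * u) = norm (1 - cnj u * v)"
    by (metis complex_cnj_cnj complex_cnj_diff complex_cnj_mult complex_cnj_one complex_mod_cnj mult.commute)
  then show ?thesis
    by (simp add: poincare_dist_def Moebius_function_simple norm_divide norm_minus_commute)
qed

lemma holomorphic_disc_recentre:
  assumes "holomorphic_disc D f" "u \<in> ball 0 1" "v \<in> ball 0 1"
  obtains g s where "holomorphic_disc D g" "norm s < 1" "g 0 = f u" "g s = f v"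
    "artanh (norm s) = poincare_dist u v"
proof
  let ?M = "Moebius_function 0 (-u)"
  let ?s = "Moebius_function 0 u v"
  have u: "norm u < 1" and v: "norm v < 1" using assms by auto
  have M: "?M holomorphic_on ball 0 1" "?M ` ball 0 1 \<subseteq> ball 0 1"
    using Moebius_function_holomorphic[of "-u"] Moebius_function_norm_lt_1[of "-u"] u by auto
  have f: "(\<lambda>t. fst (f t)) holomorphic_on ball 0 1" "(\<lambda>t. snd (f t)) holomorphic_on ball 0 1"
    "f ` ball 0 1 \<subseteq> D"
    using assms(1) by (auto simp: holomorphic_disc_def)
  show "holomorphic_disc D (f \<circ> ?M)"
    unfolding holomorphic_disc_def o_def
    using holomorphic_on_compose_gen[OF M(1) f(1) M(2)] holomorphic_on_compose_gen[OF M(1) f(2) M(2)] f(3) M(2)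
    by (auto simp: o_def)
  show "norm ?s < 1" by (rule Moebius_function_norm_lt_1[OF u v])
  show "(f \<circ> ?M) 0 = f u" by (simp add: Moebius_function_of_zero)
  show "(f \<circ> ?M) ?s = f v" using Moebius_function_compose[of "-u" u v] u v by simp
  show "artanh (norm ?s) = poincare_dist u v" by (simp add: poincare_dist_eq_Moebius)
qed

text \<open>After composing each disc with an automorphism of the unit disc, every link of a chain starts at
  parameter \<open>0\<close>; the radial estimates then apply to it.\<close>

lemma kobayashi_chain_recentre:
  assumes "L \<in> kobayashi_chain_lengths D p q"
  shows "\<exists>(n::nat) x g s. x 0 = p \<and> x n = q \<and>
    (\<forall>i<n. holomorphic_disc D (g i) \<and> norm (s i) < 1 \<and> g i 0 = x i \<and> g i (s i) = x (Suc i)) \<and>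
    L = (\<Sum>i<n. artanh (norm (s i)))"
proof -
  obtain n x u v f where x: "x 0 = p" "x n = q" and
    f: "\<And>i. i < n \<Longrightarrow> u i \<in> ball 0 1 \<and> v i \<in> ball 0 1 \<and> holomorphic_disc D (f i) \<and>
               f i (u i) = x i \<and> f i (v i) = x (Suc i)" and
    L: "L = (\<Sum>i<n. poincare_dist (u i) (v i))"
    using assms unfolding kobayashi_chain_lengths_def by blast
  have "\<forall>i. \<exists>g s. i < n \<longrightarrow> holomorphic_disc D g \<and> norm s < 1 \<and> g 0 = x i \<and> g s = x (Suc i) \<and>
      artanh (norm s) = poincare_dist (u i) (v i)"
    using f holomorphic_disc_recentre by metis
  then obtain g s where "\<And>i. i < n \<Longrightarrow> holomorphic_disc D (g i) \<and> norm (s i) < 1 \<and> g i 0 = x i \<and>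
      g i (s i) = x (Suc i) \<and> artanh (norm (s i)) = poincare_dist (u i) (v i)"
    by metis
  with x L show ?thesis by (intro exI[of _ n] exI[of _ x] exI[of _ g] exI[of _ s]) auto
qed

lemma norm_complex_mult_pair: "norm (c * fst z, c * snd z) = norm c * norm z" for c :: complex
  by (cases z) (simp add: norm_Pair norm_mult power_mult_distrib real_sqrt_mult flip: distrib_left)

text \<open>The disc passes through \<open>x\<close> at parameter \<open>0\<close> and through \<open>y\<close> at parameter \<open>1/2\<close>.\<close>

lemma affine_disc:
  assumes "ball a r \<subseteq> D" "norm (x - a) < r / 8" "norm (y - a) < r / 8"
  shows "holomorphic_disc D (\<lambda>t. (fst x + 2 * t * (fst y - fst x), snd x + 2 * t * (snd y - snd x)))"
    (is "holomorphic_disc D ?f")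
  unfolding holomorphic_disc_def
proof (intro conjI image_subsetI)
  fix t :: complex assume t: "t \<in> ball 0 1"
  have eq: "?f t - a = (x - a) + (2 * t * fst (y - x), 2 * t * snd (y - x))"
    by (simp add: prod_eq_iff)
  have "norm (?f t - a) \<le> norm (x - a) + norm (2 * t) * norm (y - x)"
    unfolding eq by (rule order_trans[OF norm_triangle_ineq]) (simp only: norm_complex_mult_pair order_refl)
  also have "\<dots> \<le> norm (x - a) + 2 * (norm (y - a) + norm (x - a))"
    using t norm_triangle_ineq4[of "y - a" "x - a"]
    by (intro add_left_mono mult_mono) (auto simp: norm_mult)
  finally have "norm (?f t - a) < r"
    using assms(2,3) norm_ge_zero[of "x - a"] by argo
  then show "?f t \<in> D" using assms(1) by (auto simp: dist_norm norm_minus_commute)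
qed (auto intro!: holomorphic_intros)

text \<open>The infimum defining \<open>kobayashi_dist\<close> has the value expected of it only over a nonempty set, so
  a lower bound for all chain lengths bounds the distance only once some chain is known to exist.\<close>

lemma kobayashi_chain_lengths_nonempty:
  assumes D: "open D" "connected D" and pq: "p \<in> D" "q \<in> D"
  shows "kobayashi_chain_lengths D p q \<noteq> {}"
proof (rule connected_induction_simple[OF D(2) pq])
  have "holomorphic_disc D (\<lambda>_. p)" using pq by (auto simp: holomorphic_disc_def)
  then have "(\<Sum>i<(1::nat). poincare_dist 0 0) \<in> kobayashi_chain_lengths D p p"
    unfolding kobayashi_chain_lengths_def
    by (intro CollectI exI[of _ 1] exI[of _ "\<lambda>_. p"] exI[of _ "\<lambda>_. 0"] exI[of _ "\<lambda>_ _. p"]) auto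
  then show "kobayashi_chain_lengths D p p \<noteq> {}" by blast
next
  fix a assume "a \<in> D"
  then obtain r where r: "r > 0" "ball a r \<subseteq> D" using D(1) openE by blast
  have "kobayashi_chain_lengths D p y \<noteq> {}"
    if xy: "x \<in> ball a (r/8)" "y \<in> ball a (r/8)" and ne: "kobayashi_chain_lengths D p x \<noteq> {}" for x y
  proof -
    \<comment> \<open>One more disc, from \<open>x\<close> to \<open>y\<close>, is appended to the chain.\<close>
    let ?h = "\<lambda>t. (fst x + 2 * t * (fst y - fst x), snd x + 2 * t * (snd y - snd x))"
    have h: "holomorphic_disc D ?h"
      by (rule affine_disc[OF r(2)]) (use xy in \<open>auto simp: dist_norm norm_minus_commute\<close>)
    obtain n X u v f where X: "n \<ge> 1" "X 0 = p" "X n = x" and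
      f: "\<And>i. i < n \<Longrightarrow> u i \<in> ball 0 1 \<and> v i \<in> ball 0 1 \<and> holomorphic_disc D (f i) \<and>
               f i (u i) = X i \<and> f i (v i) = X (Suc i)"
      using ne unfolding kobayashi_chain_lengths_def by blast
    let ?X = "X(Suc n := y)" and ?u = "u(n := 0)" and ?v = "v(n := 1/2)" and ?f = "f(n := ?h)"
    have "?u i \<in> ball 0 1 \<and> ?v i \<in> ball 0 1 \<and> holomorphic_disc D (?f i) \<and>
               ?f i (?u i) = ?X i \<and> ?f i (?v i) = ?X (Suc i)" if "i < Suc n" for i
    proof (cases "i = n")
      case True then show ?thesis using h X by (auto simp: prod_eq_iff)
    next
      case False with that f[of i] show ?thesis by auto
    qed
    then have "(\<Sum>i<Suc n. poincare_dist (?u i) (?v i)) \<in> kobayashi_chain_lengths D p y"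
      unfolding kobayashi_chain_lengths_def using X
      by (intro CollectI exI[of _ "Suc n"] exI[of _ ?X] exI[of _ ?u] exI[of _ ?v] exI[of _ ?f]) auto
    then show ?thesis by blast
  qed
  moreover have "openin (top_of_set D) (ball a (r/8))"
  proof (rule iffD2[OF openin_open_eq[OF D(1)]], intro conjI)
    show "ball a (r/8) \<subseteq> D" using r subset_ball[of "r/8" r a] by fastforce
  qed simp
  moreover have "a \<in> ball a (r/8)" using r(1) by simp
  ultimately show "\<exists>T. openin (top_of_set D) T \<and> a \<in> T \<and>
      (\<forall>x\<in>T. \<forall>y\<in>T. kobayashi_chain_lengths D p x \<noteq> {} \<longrightarrow> kobayashi_chain_lengths D p y \<noteq> {})"
    by blast
qed

lemma kobayashi_dist_ge:
  assumes "open D" "connected D" "p \<in> D" "q \<in> D"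
    and "\<And>L. L \<in> kobayashi_chain_lengths D p q \<Longrightarrow> C \<le> L"
  shows "kobayashi_dist D p q \<ge> C"
  unfolding kobayashi_dist_def
  by (rule cInf_greatest[OF kobayashi_chain_lengths_nonempty[OF assms(1-4)] assms(5)])

text \<open>A Lipschitz bound on every link adds up to one for the whole chain, independently of the number
  of links.\<close>

lemma chain_potential_bound:
  fixes y l :: "nat \<Rightarrow> real"
  assumes step: "\<And>i. i < n \<Longrightarrow> \<bar>y (Suc i) - y i\<bar> \<le> A * l i"
    and "A \<ge> 0" and l: "\<And>i. i < n \<Longrightarrow> l i \<ge> 0" and "j \<le> n"
  shows "\<bar>y j - y n\<bar> \<le> A * (\<Sum>i<n. l i)"
proof -
  have "\<bar>y j - y n\<bar> = \<bar>\<Sum>i=j..<n. y (Suc i) - y i\<bar>"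
    using \<open>j \<le> n\<close> by (simp add: sum_Suc_diff' abs_minus_commute)
  also have "\<dots> \<le> (\<Sum>i=j..<n. A * l i)"
    by (rule order_trans[OF sum_abs]) (auto intro!: sum_mono step)
  also have "\<dots> \<le> (\<Sum>i<n. A * l i)"
    using l \<open>A \<ge> 0\<close> by (intro sum_mono2) auto
  finally show ?thesis by (simp add: sum_distrib_left)
qed

section \<open>The quadratic map in the base\<close>

lemma funpow_add_apply: "(f ^^ (m + n)) x = (f ^^ m) ((f ^^ n) x)"
  by (simp add: funpow_add)

definition quad :: "real \<Rightarrow> complex \<Rightarrow> complex" where
  "quad lam z = of_real lam * z - z\<^sup>2"

definition quad_basin :: "real \<Rightarrow> complex set" where
  "quad_basin lam = {z. (\<lambda>n. (quad lam ^^ n) z) \<longlonglongrightarrow> 0}"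

lemma continuous_on_quad_funpow: "continuous_on A (quad lam ^^ n)"
proof (induction n arbitrary: A)
  case (Suc n)
  have "continuous_on B (quad lam)" for B
    unfolding quad_def by (intro continuous_intros)
  from continuous_on_compose[OF Suc this] show ?case by (simp add: o_def)
qed auto

lemma quad_funpow_in_basin_iff: "(quad lam ^^ n) z \<in> quad_basin lam \<longleftrightarrow> z \<in> quad_basin lam"
  unfolding quad_basin_def using LIMSEQ_offset[of "\<lambda>k. (quad lam ^^ k) z" n 0]
    LIMSEQ_ignore_initial_segment[of "\<lambda>k. (quad lam ^^ k) z" 0 n]
  by (auto simp: funpow_add_apply)

lemma quad_contracts:
  assumes "0 < lam" "norm z < (1 - lam) / 2"
  shows "norm (quad lam z) \<le> (1 + lam) / 2 * norm z"
proof -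
  have "quad lam z = (of_real lam - z) * z"
    by (simp add: quad_def algebra_simps power2_eq_square)
  then have "norm (quad lam z) = norm (of_real lam - z) * norm z" by (simp add: norm_mult)
  also have "norm (of_real lam - z) \<le> (1 + lam) / 2"
    using norm_triangle_ineq4[of "of_real lam" z] assms by simp
  finally show ?thesis by (simp add: mult_right_mono)
qed

lemma quad_funpow_contracts:
  assumes lam: "0 < lam" "lam < 1" and z: "norm z < (1 - lam) / 2"
  shows "norm ((quad lam ^^ n) z) \<le> ((1 + lam) / 2) ^ n * norm z"
proof (induction n)
  case (Suc n)
  have "((1 + lam) / 2) ^ n * norm z \<le> 1 * norm z"
    using lam by (intro mult_right_mono power_le_one) auto
  then have "norm ((quad lam ^^ n) z) < (1 - lam) / 2" using Suc z by simp
  from quad_contracts[OF lam(1) this]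
  have "norm ((quad lam ^^ Suc n) z) \<le> (1 + lam) / 2 * norm ((quad lam ^^ n) z)" by simp
  also have "\<dots> \<le> (1 + lam) / 2 * (((1 + lam) / 2) ^ n * norm z)"
    using lam by (intro mult_left_mono Suc) auto
  finally show ?case by simp
qed simp

lemma quad_funpow_norm_le:
  assumes "0 < lam" "lam < 1" "norm z < (1 - lam) / 2"
  shows "norm ((quad lam ^^ n) z) \<le> norm z"
proof -
  have "((1 + lam) / 2) ^ n * norm z \<le> 1 * norm z"
    using assms by (intro mult_right_mono power_le_one) auto
  then show ?thesis using quad_funpow_contracts[OF assms, of n] by simp
qed

lemma small_in_quad_basin:
  assumes "0 < lam" "lam < 1" "norm z < (1 - lam) / 2"
  shows "z \<in> quad_basin lam"
  unfolding quad_basin_def mem_Collect_eq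
proof (rule Lim_null_comparison)
  show "(\<lambda>n. ((1 + lam) / 2) ^ n * norm z) \<longlonglongrightarrow> 0"
    using assms by (intro tendsto_mult_left_zero LIMSEQ_realpow_zero) auto
qed (use quad_funpow_contracts[OF assms] in simp)

lemma quad_basin_eventually_small:
  assumes "z \<in> quad_basin lam" "r > 0"
  shows "\<exists>n. norm ((quad lam ^^ n) z) < r"
proof -
  have "\<forall>\<^sub>F n in sequentially. norm ((quad lam ^^ n) z) < r"
    using assms unfolding quad_basin_def mem_Collect_eq tendsto_iff by (auto simp: dist_norm)
  then show ?thesis by (auto simp: eventually_sequentially)
qed

lemma open_quad_basin:
  assumes "0 < lam" "lam < 1"
  shows "open (quad_basin lam)"
proof -
  have "quad_basin lam = (\<Union>n. (quad lam ^^ n) -` ball 0 ((1 - lam) / 2))"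
    using quad_basin_eventually_small[of _ lam "(1 - lam) / 2"]
      small_in_quad_basin[OF assms] quad_funpow_in_basin_iff[of _ lam] assms
    by (auto, metis)
  then show ?thesis
    by (metis open_UN open_vimage open_ball continuous_on_quad_funpow)
qed

text \<open>The sets where the \<open>n\<close>-th iterate lies in a small disc that is contracted into itself increase with
  \<open>n\<close>, so one of them contains the compact set.\<close>

lemma quad_funpow_uniformly_small:
  assumes lam: "0 < lam" "lam < 1" and K: "compact K" "K \<subseteq> quad_basin lam" and "r > 0"
  obtains m where "\<And>n z. n \<ge> m \<Longrightarrow> z \<in> K \<Longrightarrow> norm ((quad lam ^^ n) z) < r"
proof -
  define s where "s = min r ((1 - lam) / 2)"
  have s: "s > 0" using assms by (simp add: s_def)
  define U where "U = (\<lambda>n. (quad lam ^^ n) -` ball 0 s)"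
  have "\<forall>n\<in>UNIV. open (U n)"
    unfolding U_def using open_vimage[OF open_ball continuous_on_quad_funpow] by auto
  moreover have "K \<subseteq> (\<Union>n\<in>UNIV. U n)"
    using quad_basin_eventually_small[of _ lam s] K(2) s by (auto simp: U_def)
  ultimately obtain N where N: "finite N" "K \<subseteq> (\<Union>n\<in>N. U n)"
    using compactE_image[OF K(1), of UNIV U] by auto
  define m where "m = Max (insert 0 N)"
  show thesis
  proof (rule that[of m])
    fix n z assume n: "n \<ge> m" and "z \<in> K"
    then obtain j where j: "j \<in> N" "norm ((quad lam ^^ j) z) < s" using N by (auto simp: U_def)
    then have "j \<le> n" using n N(1) Max_ge[of "insert 0 N" j] by (simp add: m_def)
    then have "(quad lam ^^ n) z = (quad lam ^^ (n - j)) ((quad lam ^^ j) z)"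
      using funpow_add_apply[of "n - j" j] by simp
    then show "norm ((quad lam ^^ n) z) < r"
      using quad_funpow_norm_le[OF lam, of "(quad lam ^^ j) z" "n - j"] j(2) by (simp add: s_def)
  qed
qed

lemma quad_basin_bounded:
  assumes "0 < lam" "lam < 1" "z \<in> quad_basin lam"
  shows "norm z \<le> 2"
proof (rule ccontr)
  assume big: "\<not> norm z \<le> 2"
  have "norm ((quad lam ^^ n) z) > 2" for n
  proof (induction n)
    case (Suc n)
    define y where "y = (quad lam ^^ n) z"
    have y: "norm y > 2" using Suc by (simp add: y_def)
    have "norm (quad lam y) = norm (y - of_real lam) * norm y"
      by (simp add: quad_def norm_mult[symmetric] norm_minus_commute algebra_simps power2_eq_square)
    moreover have "norm (y - of_real lam) \<ge> 1"
      using norm_triangle_ineq2[of y "of_real lam"] y assms by simp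
    ultimately have "norm (quad lam y) \<ge> norm y"
      using mult_right_mono[of 1 "norm (y - of_real lam)" "norm y"] by simp
    then show ?case using y by (simp add: y_def)
  qed (use big in simp)
  then show False using quad_basin_eventually_small[OF assms(3), of 2] by (meson less_asym zero_less_numeral)
qed

text \<open>The first point is fixed and the second is mapped to it.  Two omitted points at distance greater
  than \<open>1\<close> from each other ensure that one of them is far from any third omitted point.\<close>

lemma repelling_fixpoint_notin_quad_basin:
  assumes "lam < 1"
  shows "of_real (lam - 1) \<notin> quad_basin lam" "1 \<notin> quad_basin lam"
proof -
  have fp: "quad lam (of_real (lam - 1)) = of_real (lam - 1)"
    by (simp add: quad_def algebra_simps power2_eq_square)
  have "(quad lam ^^ n) (of_real (lam - 1)) = of_real (lam - 1)" for n
    by (induction n) (use fp in auto)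
  then show *: "of_real (lam - 1) \<notin> quad_basin lam"
    using assms by (auto simp: quad_basin_def LIMSEQ_const_iff simp del: of_real_diff)
  have "(quad lam ^^ 1) 1 = of_real (lam - 1)" by (simp add: quad_def)
  then show "1 \<notin> quad_basin lam" using * quad_funpow_in_basin_iff[of 1 lam 1] by simp
qed

section \<open>The skew product, its fibres and its basin\<close>

lemma F_map_apply: "F_map lam a x = (quad lam (fst x), snd x - (snd x)\<^sup>2 + a * fst x * snd x ^ 3)"
  by (cases x) (simp add: F_map_def quad_def)

lemma fst_F_funpow: "fst ((F_map lam a ^^ n) x) = (quad lam ^^ n) (fst x)"
  by (induction n) (simp_all add: F_map_apply)

lemma snd_F_funpow_Suc:
  "snd ((F_map lam a ^^ Suc n) x) =
     snd ((F_map lam a ^^ n) x) - (snd ((F_map lam a ^^ n) x))\<^sup>2 +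
     a * (quad lam ^^ n) (fst x) * snd ((F_map lam a ^^ n) x) ^ 3"
  by (simp add: F_map_apply fst_F_funpow)

lemma continuous_on_F_funpow: "continuous_on A (F_map lam a ^^ n)"
proof (induction n arbitrary: A)
  case (Suc n)
  have "continuous_on B (F_map lam a)" for B
    unfolding F_map_apply[abs_def] quad_def by (intro continuous_intros)
  from continuous_on_compose[OF Suc this] show ?case by (simp add: o_def)
qed auto

lemma F_funpow_holomorphic:
  assumes "(\<lambda>t. fst (f t)) holomorphic_on S" "(\<lambda>t. snd (f t)) holomorphic_on S"
  shows "(\<lambda>t. fst ((F_map lam a ^^ n) (f t))) holomorphic_on S \<and>
         (\<lambda>t. snd ((F_map lam a ^^ n) (f t))) holomorphic_on S"
proof (induction n)
  case (Suc n)
  then show ?case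
    unfolding funpow.simps o_def F_map_apply quad_def fst_conv snd_conv
    by (auto intro!: holomorphic_intros)
qed (use assms in auto)

lemma fibre_map_holomorphic: "(\<lambda>y. snd ((F_map lam a ^^ n) (z, y))) holomorphic_on S"
  using F_funpow_holomorphic[of "\<lambda>y. (z, y)" S n lam a] by (auto intro!: holomorphic_intros)

lemma fibre_map_tangent_to_identity:
  "snd ((F_map lam a ^^ n) (z, 0)) = 0 \<and>
   ((\<lambda>y. snd ((F_map lam a ^^ n) (z, y))) has_field_derivative 1) (at 0)"
proof (induction n)
  case (Suc n)
  then show ?case unfolding snd_F_funpow_Suc
    by (auto intro!: derivative_eq_intros)
qed auto

lemma filterlim_cubic_at_infinity:
  "filterlim (\<lambda>y::complex. y - y\<^sup>2 + c * y ^ 3) at_infinity at_infinity"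
  unfolding filterlim_at_infinity[OF order_refl]
proof (intro allI impI)
  fix r :: real
  have "\<exists>r'. \<forall>z. r' \<le> norm z \<longrightarrow> r \<le> norm (poly (pCons 0 [:1, -1, c:]) z)"
    by (rule poly_infinity) simp
  moreover have "poly (pCons 0 [:1, -1, c:]) y = y - y\<^sup>2 + c * y ^ 3" for y
    by (simp add: algebra_simps power2_eq_square power3_eq_cube)
  ultimately show "\<forall>\<^sub>F y in at_infinity. r \<le> norm (y - y\<^sup>2 + c * y ^ 3)"
    unfolding eventually_at_infinity by metis
qed

lemma fibre_map_proper:
  "filterlim (\<lambda>y. snd ((F_map lam a ^^ n) (z, y))) at_infinity at_infinity"
proof (induction n)
  case (Suc n)
  from filterlim_compose[OF filterlim_cubic_at_infinity[of "a * (quad lam ^^ n) z"] Suc]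
  show ?case unfolding snd_F_funpow_Suc by simp
qed (simp add: filterlim_ident)

text \<open>If the orbit hits \<open>w = 0\<close> at time \<open>n\<close>, then moving the starting point within its fibre covers a
  disc around \<open>0\<close> in the fibre reached at time \<open>n\<close>.  The later iterates on that disc converge
  uniformly to \<open>0\<close>, yet they all have derivative \<open>1\<close> at \<open>0\<close>, against the Cauchy estimate.\<close>

lemma F_orbit_snd_nonzero_on_basin:
  assumes x: "x \<in> attracting_basin (F_map lam a) (0, 0)"
  shows "snd ((F_map lam a ^^ n) x) \<noteq> 0"
proof
  assume zero: "snd ((F_map lam a ^^ n) x) = 0"
  obtain z w where xeq: "x = (z, w)" by (cases x)
  let ?F = "F_map lam a"
  obtain U where U: "open U" "x \<in> U" "uniform_limit U (\<lambda>n. ?F ^^ n) (\<lambda>_. (0, 0)) sequentially"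
    using x unfolding attracting_basin_def by auto
  define U' where "U' = (\<lambda>y. (z, y)) -` U"
  define H where "H = (\<lambda>y. snd ((?F ^^ n) (z, y)))"
  have U': "open U'" "w \<in> U'"
    unfolding U'_def using U xeq by (auto intro!: open_vimage continuous_intros)
  have holH: "H holomorphic_on UNIV" unfolding H_def by (rule fibre_map_holomorphic)
  have nonconst: "\<not> H constant_on UNIV"
  proof
    assume "H constant_on UNIV"
    then obtain c where "H = (\<lambda>_. c)" unfolding constant_on_def by auto
    moreover have "(H has_field_derivative 1) (at 0)"
      using fibre_map_tangent_to_identity unfolding H_def by blast
    ultimately show False using DERIV_unique[OF _ DERIV_const, of c 1 0] by simp
  qed
  have "open (H ` U')"
    using open_mapping_thm[OF holH open_UNIV connected_UNIV U'(1) _ nonconst] by simp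
  moreover have "0 \<in> H ` U'" using U'(2) zero xeq by (force simp: H_def)
  ultimately obtain r where r: "r > 0" "cball 0 r \<subseteq> H ` U'"
    by (meson open_contains_cball)
  have "\<forall>\<^sub>F j in sequentially. \<forall>y\<in>U. dist ((?F ^^ j) y) (0, 0) < r / 2"
    using U(3)[unfolded uniform_limit_iff, rule_format, of "r / 2"] r(1) by simp
  then obtain N where N: "\<And>j y. j \<ge> N \<Longrightarrow> y \<in> U \<Longrightarrow> dist ((?F ^^ j) y) (0, 0) < r / 2"
    unfolding eventually_sequentially by auto
  define T where "T = (\<lambda>y. snd ((?F ^^ N) ((quad lam ^^ n) z, y)))"
  have small: "norm (T y) \<le> r / 2" if "norm y \<le> r" for y
  proof -
    obtain y' where y': "y' \<in> U'" "y = H y'" using r(2) \<open>norm y \<le> r\<close> by auto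
    have "((quad lam ^^ n) z, y) = (?F ^^ n) (z, y')"
      using y' fst_F_funpow[of n lam a "(z, y')"] by (simp add: H_def prod_eq_iff)
    then have "T y = snd ((?F ^^ (N + n)) (z, y'))" by (simp add: T_def funpow_add)
    moreover have "dist ((?F ^^ (N + n)) (z, y')) (0, 0) < r / 2"
      using N[of "N + n" "(z, y')"] y'(1) by (simp add: U'_def)
    ultimately show ?thesis
      using dist_snd_le[of "(?F ^^ (N + n)) (z, y')" "(0, 0)"] by (simp add: dist_norm)
  qed
  have holT: "T holomorphic_on S" for S unfolding T_def by (rule fibre_map_holomorphic)
  have "norm ((deriv ^^ 1) T 0) \<le> fact 1 * (r / 2) / r ^ 1"
    by (rule Cauchy_inequality[OF holT holomorphic_on_imp_continuous_on[OF holT] r(1)])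
       (use small in auto)
  moreover have "deriv T 0 = 1"
    using fibre_map_tangent_to_identity unfolding T_def by (blast intro: DERIV_imp_deriv)
  ultimately show False using r(1) by simp
qed

lemma fst_basin_subset_quad_basin:
  assumes "x \<in> attracting_basin (F_map lam a) (0, 0)"
  shows "fst x \<in> quad_basin lam"
proof -
  obtain U where U: "x \<in> U" "uniform_limit U (\<lambda>n. F_map lam a ^^ n) (\<lambda>_. (0, 0)) sequentially"
    using assms unfolding attracting_basin_def by auto
  have "(\<lambda>n. (F_map lam a ^^ n) x) \<longlonglongrightarrow> (0, 0)"
    using tendsto_uniform_limitI[OF U(2,1)] .
  from tendsto_fst[OF this] show ?thesis by (simp add: quad_basin_def fst_F_funpow)
qed

lemma open_attracting_basin: "open (attracting_basin f c)"
proof -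
  have "\<exists>U. open U \<and> x \<in> U \<and> U \<subseteq> attracting_basin f c" if "x \<in> attracting_basin f c" for x
    using that unfolding attracting_basin_def by blast
  then show ?thesis by (meson open_subopen)
qed

section \<open>The parabolic petal\<close>

text \<open>The disc that \<open>w \<mapsto> 1/w\<close> maps onto the half plane of points with real part greater than \<open>R\<close>.\<close>

definition petal :: "real \<Rightarrow> complex set" where
  "petal R = ball (of_real (1 / (2 * R))) (1 / (2 * R))"

lemma mem_petal_iff:
  assumes "R > 0"
  shows "w \<in> petal R \<longleftrightarrow> w \<noteq> 0 \<and> R < Re (1 / w)"
proof -
  have "w \<in> petal R \<longleftrightarrow> (norm (w - of_real (1 / (2 * R))))\<^sup>2 < (1 / (2 * R))\<^sup>2"
    unfolding petal_def mem_ball dist_norm using assms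
    by (subst norm_minus_commute) (auto simp: power_mono_iff intro: power_strict_mono power_less_imp_less_base)
  also have "\<dots> \<longleftrightarrow> R * (norm w)\<^sup>2 < Re w"
  proof -
    have "(norm (w - of_real c))\<^sup>2 = (norm w)\<^sup>2 - 2 * c * Re w + c\<^sup>2" for c
      unfolding cmod_power2 by (simp add: power2_eq_square algebra_simps)
    from this[of "1 / (2 * R)"]
    have "(norm (w - of_real (1 / (2 * R))))\<^sup>2 < (1 / (2 * R))\<^sup>2 \<longleftrightarrow> (norm w)\<^sup>2 < Re w / R"
      by simp
    also have "\<dots> \<longleftrightarrow> R * (norm w)\<^sup>2 < Re w"
      using assms by (simp add: less_divide_eq mult.commute)
    finally show ?thesis .
  qed
  also have "\<dots> \<longleftrightarrow> w \<noteq> 0 \<and> R < Re (1 / w)"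
  proof (cases "w = 0")
    case False
    then have "Re (1 / w) = Re w / (norm w)\<^sup>2"
      by (simp add: Re_divide cmod_power2)
    then show ?thesis using False by (simp add: less_divide_eq)
  qed simp
  finally show ?thesis .
qed

lemma petal_norm_less:
  assumes "R > 0" "w \<in> petal R"
  shows "norm w < 1 / R"
proof -
  have w: "w \<noteq> 0" "R < Re (1 / w)" using assms mem_petal_iff by auto
  have "R < norm (1 / w)" using w(2) complex_Re_le_cmod[of "1 / w"] by linarith
  then show ?thesis using w(1) assms(1) by (simp add: norm_divide field_simps)
qed

text \<open>In the coordinate \<open>1/w\<close> the fibre map is a translation by \<open>1\<close> up to a small error.\<close>

lemma petal_step:
  assumes R: "R \<ge> 16 * (1 + norm a)" and w: "w \<in> petal R" and z: "norm z \<le> 1"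
  defines "w' \<equiv> w - w\<^sup>2 + a * z * w ^ 3"
  shows "w' \<noteq> 0" "Re (1 / w') \<ge> Re (1 / w) + 1 / 2"
proof -
  have A: "1 + norm a > 0" by (simp add: add_pos_nonneg)
  then have R0: "R > 0" using R by argo
  have w0: "w \<noteq> 0" using w mem_petal_iff[OF R0] by auto
  have "norm w * (16 * (1 + norm a)) \<le> norm w * R" using R by (intro mult_left_mono) auto
  also have "\<dots> \<le> 1" using petal_norm_less[OF R0 w] R0 by (simp add: field_simps)
  finally have wa: "norm w + norm a * norm w \<le> 1 / 16" by (simp add: algebra_simps)
  have aw0: "norm a * norm w \<ge> 0" by simp
  have w16: "norm w \<le> 1 / 16" "norm a * norm w \<le> 1 / 16"
    using wa aw0 norm_ge_zero[of w] by linarith+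
  have az: "norm (a * z) \<le> norm a"
    using mult_left_mono[OF z, of "norm a"] by (simp add: norm_mult)
  have azw: "norm (a * z * w) \<le> 1 / 16"
    using mult_right_mono[OF az, of "norm w"] w16 by (simp add: norm_mult)
  have azww: "norm (a * z * w * w) \<le> 1 / 16 * (1 / 16)"
    unfolding norm_mult[of "a * z * w"] using azw w16 by (intro mult_mono) auto
  define u where "u = 1 - w + a * z * w\<^sup>2"
  define E where "E = w * (1 - a * z - a * z * w) / u"
  have u: "norm u \<ge> 7 / 8"
  proof -
    have "norm (1::complex) \<le> norm u + norm (w - a * z * w * w)"
      using norm_triangle_ineq[of u "w - a * z * w * w"] by (simp add: u_def power2_eq_square algebra_simps)
    moreover have "norm (w - a * z * w * w) \<le> norm w + norm (a * z * w * w)" by (rule norm_triangle_ineq4)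
    ultimately show ?thesis using w16 azww by simp
  qed
  then have u0: "u \<noteq> 0" by auto
  have w'u: "w' = w * u" by (simp add: w'_def u_def algebra_simps power2_eq_square power3_eq_cube)
  then show "w' \<noteq> 0" using w0 u0 by simp
  \<comment> \<open>The error is \<open>E = 1/w' - 1/w - 1\<close> in closed form, which shows that it is of order \<open>w\<close>.\<close>
  have eq: "1 / w' = 1 / w + 1 + E"
  proof -
    have "1 / w + 1 + E = (u + w * u + w\<^sup>2 * (1 - a * z - a * z * w)) / (w * u)"
      using w0 u0 by (simp add: E_def divide_simps) (simp add: algebra_simps power2_eq_square)
    also have "u + w * u + w\<^sup>2 * (1 - a * z - a * z * w) = 1"
      by (simp add: u_def algebra_simps power2_eq_square)
    finally show ?thesis using w'u by simp
  qed
  have "norm (w * (1 - a * z - a * z * w)) \<le> 1 / 4"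
  proof -
    have e: "w * (1 - a * z - a * z * w) = w - a * z * w - a * z * w * w" by (simp add: algebra_simps)
    have "norm (w - a * z * w - a * z * w * w) \<le> norm w + norm (a * z * w) + norm (a * z * w * w)"
      using norm_triangle_ineq4[of "w - a * z * w" "a * z * w * w"] norm_triangle_ineq4[of w "a * z * w"]
      by linarith
    then show ?thesis unfolding e using w16 azw azww by linarith
  qed
  then have "norm E \<le> 1 / 4 / (7 / 8)"
    unfolding E_def norm_divide using u by (intro frac_le) auto
  then have "\<bar>Re E\<bar> \<le> 1 / 2" using abs_Re_le_cmod[of E] by simp
  then show "Re (1 / w') \<ge> Re (1 / w) + 1 / 2" unfolding eq by simp
qed

lemma petal_orbit:
  assumes lam: "0 < lam" "lam < 1" and R: "R \<ge> 16 * (1 + norm a)"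
    and w: "w \<in> petal R" and z: "norm z < (1 - lam) / 2"
  defines "w' \<equiv> \<lambda>n. snd ((F_map lam a ^^ n) (z, w))"
  shows "w' n \<noteq> 0 \<and> Re (1 / w' n) \<ge> Re (1 / w) + real n / 2"
proof (induction n)
  case 0
  have "R > 0" using R norm_ge_zero[of a] by argo
  then show ?case using w mem_petal_iff by (auto simp: w'_def)
next
  case (Suc n)
  have R0: "R > 0" using R norm_ge_zero[of a] by argo
  then have "R < Re (1 / w)" using w mem_petal_iff by auto
  then have wn: "w' n \<in> petal R" using Suc mem_petal_iff[OF R0] by auto
  have zn: "norm ((quad lam ^^ n) z) \<le> 1" using quad_funpow_norm_le[OF lam z, of n] z lam by argo
  have eq: "w' (Suc n) = w' n - (w' n)\<^sup>2 + a * (quad lam ^^ n) z * w' n ^ 3"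
    unfolding w'_def snd_F_funpow_Suc by simp
  from petal_step[OF R wn zn] Suc show ?case unfolding eq by (auto simp: field_simps)
qed

lemma petal_orbit_norm:
  assumes lam: "0 < lam" "lam < 1" and R: "R \<ge> 16 * (1 + norm a)"
    and w: "w \<in> petal R" and z: "norm z < (1 - lam) / 2"
  shows "norm (snd ((F_map lam a ^^ n) (z, w))) \<le> 1 / (Re (1 / w) + real n / 2)"
proof -
  define v where "v = snd ((F_map lam a ^^ n) (z, w))"
  have R0: "R > 0" using R norm_ge_zero[of a] by argo
  then have pos: "Re (1 / w) > 0" using w mem_petal_iff by fastforce
  have v: "v \<noteq> 0" "Re (1 / w) + real n / 2 \<le> Re (1 / v)"
    using petal_orbit[OF lam R w z, of n] by (auto simp: v_def)
  then have "Re (1 / w) + real n / 2 \<le> 1 / norm v"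
    using complex_Re_le_cmod[of "1 / v"] by (simp add: norm_divide)
  then show ?thesis using pos v(1) unfolding v_def[symmetric] by (simp add: field_simps)
qed

lemma petal_preimage_in_basin:
  assumes lam: "0 < lam" "lam < 1" and R: "R \<ge> 16 * (1 + norm a)"
    and x: "(F_map lam a ^^ k) x \<in> ball 0 ((1 - lam) / 2) \<times> petal R"
  shows "x \<in> attracting_basin (F_map lam a) (0, 0)"
proof -
  let ?F = "F_map lam a"
  define U where "U = (?F ^^ k) -` (ball 0 ((1 - lam) / 2) \<times> petal R)"
  have R0: "R > 0" using R norm_ge_zero[of a] by argo
  have "open U"
    unfolding U_def petal_def by (intro open_vimage continuous_on_F_funpow open_Times open_ball)
  moreover have "uniform_limit U (\<lambda>n. ?F ^^ n) (\<lambda>_. (0, 0)) sequentially"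
    unfolding uniform_limit_iff
  proof (intro allI impI)
    fix e :: real assume e: "e > 0"
    have "(\<lambda>n. ((1 + lam) / 2) ^ n + 1 / (R + real n / 2)) \<longlonglongrightarrow> 0 + 0"
    proof (rule tendsto_add)
      show "(\<lambda>n. ((1 + lam) / 2) ^ n) \<longlonglongrightarrow> 0" using lam by (intro LIMSEQ_realpow_zero) auto
      show "(\<lambda>n. 1 / (R + real n / 2)) \<longlonglongrightarrow> 0"
        using R0 by real_asymp
    qed
    then have "\<forall>\<^sub>F n in sequentially. ((1 + lam) / 2) ^ n + 1 / (R + real n / 2) < e"
      using e by (auto dest: order_tendstoD(2))
    then obtain N where N: "\<And>n. n \<ge> N \<Longrightarrow> ((1 + lam) / 2) ^ n + 1 / (R + real n / 2) < e"
      unfolding eventually_sequentially by auto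
    have "dist ((?F ^^ n) y) (0, 0) < e" if n: "n \<ge> N + k" and y: "y \<in> U" for n y
    proof -
      obtain z w where zw: "(?F ^^ k) y = (z, w)" by fastforce
      have z: "norm z < (1 - lam) / 2" and w: "w \<in> petal R" using y zw by (auto simp: U_def)
      define j where "j = n - k"
      have eq: "(?F ^^ n) y = (?F ^^ j) (z, w)"
        using n zw funpow_add_apply[of j k ?F y] by (simp add: j_def)
      have "dist ((?F ^^ n) y) (0, 0) \<le> norm (fst ((?F ^^ j) (z, w))) + norm (snd ((?F ^^ j) (z, w)))"
        unfolding eq using norm_Pair_le[of "fst ((?F ^^ j) (z, w))" "snd ((?F ^^ j) (z, w))"]
        by (simp add: dist_norm flip: zero_prod_def)
      also have "norm (fst ((?F ^^ j) (z, w))) \<le> ((1 + lam) / 2) ^ j * norm z"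
        using quad_funpow_contracts[OF lam z, of j] by (simp add: fst_F_funpow)
      also have "\<dots> \<le> ((1 + lam) / 2) ^ j * 1"
        using z lam by (intro mult_left_mono) auto
      also have "norm (snd ((?F ^^ j) (z, w))) \<le> 1 / (Re (1 / w) + real j / 2)"
        by (rule petal_orbit_norm[OF lam R w z])
      also have "\<dots> \<le> 1 / (R + real j / 2)"
        using R0 w mem_petal_iff[OF R0] by (intro divide_left_mono) (auto intro!: mult_pos_pos add_pos_nonneg)
      finally show ?thesis using N[of j] n unfolding j_def by linarith
    qed
    then show "\<forall>\<^sub>F n in sequentially. \<forall>y\<in>U. dist ((?F ^^ n) y) (0, 0) < e"
      unfolding eventually_sequentially by blast
  qed
  ultimately show ?thesis using x unfolding attracting_basin_def U_def by auto
qed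

text \<open>The image of the component is open by the open mapping theorem and relatively closed because \<open>P\<close>
  is proper, so it is all of the connected set \<open>W\<close>.\<close>

lemma proper_holomorphic_component_surj:
  assumes hol: "P holomorphic_on UNIV" and proper: "filterlim P at_infinity at_infinity"
    and W: "open W" "connected W" and y0: "P y0 \<in> W"
  shows "P ` connected_component_set (P -` W) y0 = W"
proof -
  define V where "V = connected_component_set (P -` W) y0"
  have cont: "continuous_on UNIV P" using hol by (rule holomorphic_on_imp_continuous_on)
  have pre: "open (P -` W)" using W(1) cont by (rule open_vimage)
  have V: "open V" "y0 \<in> V" "V \<subseteq> P -` W"
    unfolding V_def using pre y0 connected_component_subset[of "P -` W" y0]
    by (auto intro: open_connected_component connected_component_refl)
  have nonconst: "\<not> P constant_on UNIV"
  proof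
    assume "P constant_on UNIV"
    then obtain c where c: "\<And>y. P y = c" unfolding constant_on_def by auto
    have "\<forall>\<^sub>F y in at_infinity. norm (P y) \<ge> norm c + 1"
      using proper unfolding filterlim_at_infinity[OF order_refl]
      by (simp add: add_nonneg_pos)
    then obtain b where "\<And>y. b \<le> norm y \<Longrightarrow> norm (P y) \<ge> norm c + 1"
      unfolding eventually_at_infinity by auto
    from this[of "of_real \<bar>b\<bar>"] show False by (simp add: c abs_ge_self)
  qed
  have op: "open (P ` V)"
    using open_mapping_thm[OF hol open_UNIV connected_UNIV V(1) _ nonconst] by simp
  have cl: "w \<in> P ` V" if w: "w \<in> W" "w \<in> closure (P ` V)" for w
  proof -
    obtain u where u: "\<And>n. u n \<in> P ` V" "u \<longlonglongrightarrow> w"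
      using w(2) closure_sequential by blast
    have "\<exists>y. y \<in> V \<and> u n = P y" for n using u(1)[of n] by blast
    then obtain v where v: "\<And>n. v n \<in> V" "\<And>n. u n = P (v n)" by metis
    have "Bseq u" using u(2) by (intro convergent_imp_Bseq convergentI)
    then obtain b where b: "b > 0" "\<And>n. norm (u n) \<le> b" using BseqE by blast
    have "\<forall>\<^sub>F y in at_infinity. norm (P y) \<ge> b + 1"
      using proper b unfolding filterlim_at_infinity[OF order_refl] by simp
    then obtain B where B: "\<And>y. norm y \<ge> B \<Longrightarrow> norm (P y) \<ge> b + 1"
      unfolding eventually_at_infinity by auto
    have "v n \<in> cball 0 B" for n
      using B[of "v n"] b(2)[of n] v(2)[of n] by (cases "norm (v n) \<ge> B") auto
    then obtain l r where l: "strict_mono r" "(v \<circ> r) \<longlonglongrightarrow> l"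
      using compact_cball[of "0::complex" B] unfolding compact_def by blast
    have "(\<lambda>n. P (v (r n))) \<longlonglongrightarrow> P l"
      using continuous_on_tendsto_compose[OF cont l(2)] by (simp add: o_def)
    moreover have "(\<lambda>n. P (v (r n))) \<longlonglongrightarrow> w"
      using LIMSEQ_subseq_LIMSEQ[OF u(2) l(1)] by (simp add: o_def v(2))
    ultimately have lw: "P l = w" using LIMSEQ_unique by blast
    then obtain e where e: "e > 0" "ball l e \<subseteq> P -` W"
      using pre w(1) openE[of "P -` W" l] by auto
    have "\<forall>\<^sub>F n in sequentially. v (r n) \<in> ball l e"
      using topological_tendstoD[OF l(2) open_ball, of l e] e(1) by (simp add: o_def)
    then obtain n where n: "v (r n) \<in> ball l e" by (meson eventually_happens sequentially_bot)
    have "connected_component (P -` W) (v (r n)) l"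
      unfolding connected_component_def using e n by (intro exI[of _ "ball l e"]) auto
    moreover have "connected_component (P -` W) y0 (v (r n))"
      using v(1)[of "r n"] by (simp add: V_def)
    ultimately have "l \<in> V" unfolding V_def using connected_component_trans by auto
    then show ?thesis using lw by blast
  qed
  have sub: "P ` V \<subseteq> W" using V(3) by auto
  have "openin (top_of_set W) (P ` V)" using op sub W(1) by (simp add: openin_open_eq)
  moreover have "closedin (top_of_set W) (P ` V)"
  proof -
    have "W \<inter> closure (P ` V) = P ` V"
    proof (intro equalityI subsetI)
      show "w \<in> W \<inter> closure (P ` V)" if "w \<in> P ` V" for w
        using that sub closure_subset[of "P ` V"] by (meson IntI subsetD)
    qed (rule cl, auto)
    moreover have "closedin (top_of_set W) (W \<inter> closure (P ` V))"
      by (rule closedin_closed_Int) simp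
    ultimately show ?thesis by (simp only:)
  qed
  ultimately have "P ` V = {} \<or> P ` V = W"
    using iffD1[OF connected_clopen W(2)] by blast
  then show ?thesis using V(2) unfolding V_def by blast
qed

text \<open>Lifting within the fibre \<open>z = fst q\<close> avoids the points over \<open>z = 0\<close>, near which preimages in the
  full space may escape to infinity.\<close>

lemma component_meets_petal_fibre:
  assumes lam: "0 < lam" "lam < 1" and R: "R \<ge> 16 * (1 + norm a)"
    and D: "D \<in> components (attracting_basin (F_map lam a) (0, 0))"
    and q: "q \<in> D" "(F_map lam a ^^ k) q = (z, w)"
    and z: "norm z < (1 - lam) / 2" and w: "w \<in> petal R" and w': "w' \<in> petal R"
  obtains p where "p \<in> D" "(F_map lam a ^^ k) p = (z, w')"
proof -
  let ?F = "F_map lam a"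
  define P where "P = (\<lambda>y. snd ((?F ^^ k) (fst q, y)))"
  define V where "V = connected_component_set (P -` petal R) (snd q)"
  have Pq: "P (snd q) = w" using q by (simp add: P_def)
  have PV: "P ` V = petal R"
    unfolding V_def
    by (rule proper_holomorphic_component_surj)
       (use Pq w in \<open>auto simp: P_def petal_def intro: fibre_map_holomorphic fibre_map_proper\<close>)
  have eq: "(?F ^^ k) (fst q, y) = (z, P y)" for y
    using q fst_F_funpow[of k lam a "(fst q, y)"] fst_F_funpow[of k lam a q]
    by (simp add: P_def prod_eq_iff)
  have "connected (Pair (fst q) ` V)"
    unfolding V_def by (intro connected_continuous_image continuous_intros) auto
  moreover have "Pair (fst q) ` V \<subseteq> attracting_basin ?F (0, 0)"
  proof clarify
    fix y assume "y \<in> V"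
    then have "P y \<in> petal R" using PV by blast
    then show "(fst q, y) \<in> attracting_basin ?F (0, 0)"
      using z by (intro petal_preimage_in_basin[OF lam R, where k = k]) (simp add: eq)
  qed
  moreover have "D \<inter> Pair (fst q) ` V \<noteq> {}"
  proof -
    have "snd q \<in> V" using Pq w by (simp add: V_def connected_component_refl)
    then have "q \<in> Pair (fst q) ` V" by (metis image_eqI prod.collapse)
    then show ?thesis using q(1) by blast
  qed
  ultimately have sub: "Pair (fst q) ` V \<subseteq> D" by (rule components_maximal[OF D])
  have "w' \<in> P ` V" unfolding PV by (rule w')
  then obtain v where v: "v \<in> V" "P v = w'" by auto
  show thesis
  proof (rule that)
    show "(fst q, v) \<in> D" using sub v(1) by (rule subsetD[OF _ imageI])
    show "(?F ^^ k) (fst q, v) = (z, w')" using eq v(2) by simp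
  qed
qed

section \<open>How far a chain of bounded length can move\<close>

text \<open>The basin is complete: chains of bounded length ending at \<open>\<epsilon>\<close> stay away from its complement.
  For \<open>b\<close> outside the basin let \<open>e\<close> be whichever of \<open>lam - 1\<close> and \<open>1\<close> is farther from \<open>b\<close>; then
  \<open>(z - b) / (e - b)\<close> omits \<open>0\<close> and \<open>1\<close> on the basin, and the bound on \<open>loglog\<close> of it along the
  chain keeps \<open>\<bar>z - b\<bar>\<close> above a constant that does not depend on \<open>b\<close>.  The conclusion covers
  parameters up to halfway between \<open>s i\<close> and the unit circle, so that it holds on discs around the
  whole segment from \<open>0\<close> to \<open>s i\<close>.\<close>

lemma horizontal_confinement:
  fixes lam M :: real and \<epsilon> :: complex
  assumes lam: "0 < lam" "lam < 1" and \<epsilon>: "\<epsilon> \<in> quad_basin lam"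
  shows "\<exists>K. compact K \<and> K \<subseteq> quad_basin lam \<and>
    (\<forall>(n::nat) x s f. x n = \<epsilon> \<and>
       (\<forall>i<n. f i holomorphic_on ball 0 1 \<and> f i ` ball 0 1 \<subseteq> quad_basin lam \<and>
              norm (s i) < 1 \<and> f i 0 = x i \<and> f i (s i) = x (Suc i)) \<and>
       (\<Sum>i<n. artanh (norm (s i))) \<le> M \<longrightarrow>
       (\<forall>i<n. \<forall>t. norm t \<le> (1 + norm (s i)) / 2 \<longrightarrow> f i t \<in> K))"
proof -
  define B where "B = quad_basin lam"
  obtain d where d: "d > 0" "ball \<epsilon> d \<subseteq> B"
    using open_quad_basin[OF lam] \<epsilon> openE unfolding B_def by blast
  define P where "P = 1 + (norm \<epsilon> + 1) * (2 + 1 / d)"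
  define M' where "M' = arsinh (ln P) + 2 * hyp_const * (2 * M + ln 2)"
  define \<eta> where "\<eta> = exp (- sinh M') / 2"
  define K where "K = cball 0 2 \<inter> (\<Inter>b\<in>-B. - ball b \<eta>)"
  have "closed K" unfolding K_def by (intro closed_Int closed_cball closed_INT) auto
  moreover have "bounded K" unfolding K_def by (rule bounded_Int) auto
  ultimately have "compact K" using compact_eq_bounded_closed by blast
  moreover have "K \<subseteq> quad_basin lam"
  proof
    fix z assume z: "z \<in> K"
    have "\<eta> > 0" by (simp add: \<eta>_def)
    then have "z \<in> ball z \<eta>" by simp
    moreover have "b \<notin> B \<Longrightarrow> z \<notin> ball b \<eta>" for b using z unfolding K_def by blast
    ultimately show "z \<in> quad_basin lam" unfolding B_def by blast
  qed
  moreover have "\<forall>(n::nat) x s f. x n = \<epsilon> \<and>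
       (\<forall>i<n. f i holomorphic_on ball 0 1 \<and> f i ` ball 0 1 \<subseteq> quad_basin lam \<and>
              norm (s i) < 1 \<and> f i 0 = x i \<and> f i (s i) = x (Suc i)) \<and>
       (\<Sum>i<n. artanh (norm (s i))) \<le> M \<longrightarrow>
       (\<forall>i<n. \<forall>t. norm t \<le> (1 + norm (s i)) / 2 \<longrightarrow> f i t \<in> K)"
  proof (intro allI impI, elim conjE)
    fix n :: nat and x :: "nat \<Rightarrow> complex" and s f i and t :: complex
    assume x: "x n = \<epsilon>" and
       chain: "\<forall>i<n. f i holomorphic_on ball 0 1 \<and> f i ` ball 0 1 \<subseteq> quad_basin lam \<and>
              norm (s i) < 1 \<and> f i 0 = x i \<and> f i (s i) = x (Suc i)" and
       M: "(\<Sum>i<n. artanh (norm (s i))) \<le> M" and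
       i: "i < n" and t: "norm t \<le> (1 + norm (s i)) / 2"
    have hol: "f i holomorphic_on ball 0 1" and im: "f i ` ball 0 1 \<subseteq> quad_basin lam"
      and s: "norm (s i) < 1" and f0: "f i 0 = x i" and fs: "f i (s i) = x (Suc i)"
      if "i < n" for i
      using chain that by auto
    have t1: "norm t < 1" using t s[OF i] by simp
    have fB: "f i t \<in> B" using im[OF i] t1 by (auto simp: B_def)
    have "dist b (f i t) \<ge> \<eta>" if b: "b \<notin> B" for b
    proof -
      \<comment> \<open>The two candidates are at distance \<open>2 - lam \<ge> 1\<close>, so one is at distance at least \<open>1/2\<close> from \<open>b\<close>.\<close>
      obtain e where e: "e \<notin> B" "norm (e - b) \<ge> 1 / 2" "norm e \<le> 1"
      proof -
        have "norm (of_real (2 - lam) :: complex) \<ge> 1"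
          using lam by (simp only: norm_of_real)
        then have "norm ((1 - b) - (of_real (lam - 1) - b)) \<ge> 1" by simp
        then have "norm (1 - b) \<ge> 1/2 \<or> norm (of_real (lam - 1) - b) \<ge> 1/2"
          using norm_triangle_ineq4[of "1 - b" "of_real (lam - 1) - b"] by linarith
        then show thesis
          using that[of 1] that[of "of_real (lam - 1)"] repelling_fixpoint_notin_quad_basin[OF lam(2)] lam
          by (auto simp: B_def simp del: of_real_diff)
      qed
      define g where "g = (\<lambda>z. (z - b) / (e - b))"
      have eb: "e \<noteq> b" using e by auto
      have omit: "g z \<noteq> 0 \<and> g z \<noteq> 1" if "z \<in> B" for z
        using that b e eb by (auto simp: g_def field_simps)
      have step: "\<bar>loglog (g (f j v)) - loglog (g (f j 0))\<bar> \<le> 2 * hyp_const * artanh (norm v)"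
        if "j < n" "norm v < 1" for j v
      proof (rule loglog_disc_bound[OF _ _ that(2)])
        show "(\<lambda>t. g (f j t)) holomorphic_on ball 0 1"
          unfolding g_def using eb by (intro holomorphic_intros hol that) auto
        show "g (f j t) \<noteq> 0 \<and> g (f j t) \<noteq> 1" if "t \<in> ball 0 1" for t
          using im[OF \<open>j < n\<close>] that by (intro omit) (auto simp: B_def)
      qed
      have nn: "artanh (norm (s j)) \<ge> 0" if "j < n" for j
        using s[OF that] by (intro artanh_nonneg) auto
      have "\<bar>loglog (g (x i)) - loglog (g (x n))\<bar> \<le> 2 * hyp_const * (\<Sum>i<n. artanh (norm (s i)))"
      proof (rule chain_potential_bound)
        show "\<bar>loglog (g (x (Suc j))) - loglog (g (x j))\<bar> \<le> 2 * hyp_const * artanh (norm (s j))"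
          if "j < n" for j
          using step[OF that s[OF that]] by (simp add: f0 fs that)
      qed (use nn i hyp_const_pos in auto)
      also have "\<dots> \<le> 2 * hyp_const * M"
        using M hyp_const_pos by (intro mult_left_mono) auto
      finally have A1: "\<bar>loglog (g (x i)) - loglog (g \<epsilon>)\<bar> \<le> 2 * hyp_const * M" using x by simp
      have "artanh (norm t) \<le> artanh (norm (s i)) + ln 2"
        using t s[OF i] by (intro artanh_half_step) auto
      also have "artanh (norm (s i)) \<le> (\<Sum>i<n. artanh (norm (s i)))"
        using i nn by (intro member_le_sum) auto
      finally have "artanh (norm t) \<le> M + ln 2" using M by simp
      then have "2 * hyp_const * artanh (norm t) \<le> 2 * hyp_const * (M + ln 2)"
        using hyp_const_pos by (intro mult_left_mono) auto
      then have A2: "\<bar>loglog (g (f i t)) - loglog (g (x i))\<bar> \<le> 2 * hyp_const * (M + ln 2)"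
        using step[OF i t1] f0[OF i] by simp
      have A3: "\<bar>loglog (g \<epsilon>)\<bar> \<le> arsinh (ln P)"
      proof -
        have "b \<notin> ball \<epsilon> d" using d(2) b by blast
        then have "d \<le> norm (\<epsilon> - b)" by (simp add: dist_norm)
        then show ?thesis unfolding g_def P_def by (intro loglog_ratio_bound) (use d e in auto)
      qed
      have "\<bar>loglog (g (f i t))\<bar> \<le> M'"
        using A1 A2 A3 unfolding M'_def by (simp add: algebra_simps)
      then have "exp (- sinh M') \<le> norm (g (f i t))"
        using omit[OF fB] by (intro norm_ge_of_loglog) auto
      then have "exp (- sinh M') * norm (e - b) \<le> norm (f i t - b)"
        using eb by (simp add: g_def norm_divide le_divide_eq)
      moreover have "exp (- sinh M') * norm (e - b) \<ge> exp (- sinh M') * (1 / 2)"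
        using e(2) by (intro mult_left_mono) auto
      ultimately have "exp (- sinh M') / 2 \<le> norm (f i t - b)" by linarith
      then show ?thesis by (simp add: \<eta>_def dist_norm norm_minus_commute)
    qed
    moreover have "norm (f i t) \<le> 2"
      using quad_basin_bounded[OF lam] fB by (simp add: B_def)
    ultimately show "f i t \<in> K" unfolding K_def by (simp add: not_less)
  qed
  ultimately show ?thesis by (intro exI[of _ K] conjI)
qed

text \<open>The factor \<open>(1 + sqrt (1 - 4 a z)) / 2\<close> is the reciprocal of the root \<open>w\<^sub>1 z\<close> of
  \<open>1 - w + a z w\<^sup>2\<close> with \<open>w\<^sub>1 0 = 1\<close>; dividing by \<open>w\<^sub>1 z\<close> moves the omitted curve to the constant
  \<open>1\<close>.\<close>

definition straighten :: "complex \<Rightarrow> complex \<times> complex \<Rightarrow> complex" where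
  "straighten a x = snd x * (1 + csqrt (1 - 4 * a * fst x)) / 2"

lemma one_plus_csqrt_nonzero: "1 + csqrt y \<noteq> 0"
proof
  assume "1 + csqrt y = 0"
  then have "csqrt y = - 1" by (simp add: add_eq_0_iff)
  then show False using csqrt_principal[of y] unfolding \<open>csqrt y = - 1\<close> by simp
qed

lemma straighten_eq_0_iff: "straighten a x = 0 \<longleftrightarrow> snd x = 0"
  using one_plus_csqrt_nonzero by (simp add: straighten_def)

text \<open>The value \<open>1\<close> is taken only on the curve \<open>1 - w + a z w\<^sup>2 = 0\<close>, which \<open>F_map\<close> sends into
  \<open>w = 0\<close>.\<close>

lemma straighten_ne_1:
  assumes "snd (F_map lam a x) \<noteq> 0"
  shows "straighten a x \<noteq> 1"
proof
  assume eq: "straighten a x = 1"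
  define w where "w = snd x"
  define s where "s = csqrt (1 - 4 * a * fst x)"
  have "w * s = 2 - w" using eq by (simp add: straighten_def w_def s_def algebra_simps)
  then have "w\<^sup>2 * s\<^sup>2 = (2 - w)\<^sup>2" by (metis power_mult_distrib)
  moreover have "s\<^sup>2 = 1 - 4 * a * fst x" by (simp add: s_def)
  ultimately have "w\<^sup>2 * (1 - 4 * a * fst x) = (2 - w)\<^sup>2" by simp
  then have "4 * (1 - w + a * fst x * w\<^sup>2) = 0"
    by (simp add: algebra_simps power2_eq_square)
  then have "w * (1 - w + a * fst x * w\<^sup>2) = 0" by (simp only: mult_eq_0_iff) simp
  moreover have "w * (1 - w + a * fst x * w\<^sup>2) = snd (F_map lam a x)"
    by (simp add: F_map_apply w_def algebra_simps power2_eq_square power3_eq_cube)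
  ultimately show False using assms by simp
qed

lemma straighten_norm_le:
  assumes "norm (fst x) \<le> 1"
  shows "norm (straighten a x) \<le> (2 + 2 * norm a) * norm (snd x)"
proof -
  define y where "y = 1 - 4 * a * fst x"
  have "norm (a * fst x) \<le> norm a"
    using mult_left_mono[OF assms, of "norm a"] by (simp add: norm_mult)
  then have "norm y \<le> 1 + 4 * norm a"
    using norm_triangle_ineq4[of 1 "4 * a * fst x"] by (simp add: y_def norm_mult)
  moreover have "norm (csqrt y) \<le> 1 + norm y"
  proof -
    have "norm (csqrt y) = sqrt (norm y)"
      by (metis norm_ge_zero norm_power power2_csqrt real_sqrt_unique)
    also have "\<dots> \<le> 1 + norm y"
      by (rule real_le_lsqrt) (simp_all add: power2_eq_square algebra_simps)
    finally show ?thesis .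
  qed
  ultimately have "norm (1 + csqrt y) \<le> 2 * (2 + 2 * norm a)"
    using norm_triangle_ineq[of 1 "csqrt y"] norm_ge_zero[of a] norm_one[where ?'a = complex] by argo
  then have "norm (1 + csqrt y) * norm (snd x) \<le> 2 * (2 + 2 * norm a) * norm (snd x)"
    by (rule mult_right_mono) simp
  moreover have "norm (straighten a x) = norm (1 + csqrt y) * norm (snd x) / 2"
    by (simp add: straighten_def y_def norm_mult norm_divide)
  ultimately show ?thesis by linarith
qed

lemma straighten_holomorphic:
  assumes "(\<lambda>t. fst (f t)) holomorphic_on S" "(\<lambda>t. snd (f t)) holomorphic_on S"
    and small: "\<And>t. t \<in> S \<Longrightarrow> norm (4 * a * fst (f t)) < 1"
  shows "(\<lambda>t. straighten a (f t)) holomorphic_on S"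
proof -
  have "(\<lambda>t. csqrt (1 - 4 * a * fst (f t))) holomorphic_on S"
  proof (rule holomorphic_on_csqrt')
    show "(\<lambda>t. 1 - 4 * a * fst (f t)) holomorphic_on S" by (intro holomorphic_intros assms)
    show "1 - 4 * a * fst (f t) \<notin> \<real>\<^sub>\<le>\<^sub>0" if "t \<in> S" for t
    proof
      assume "1 - 4 * a * fst (f t) \<in> \<real>\<^sub>\<le>\<^sub>0"
      then have "Re (1 - 4 * a * fst (f t)) \<le> 0" using complex_nonpos_Reals_iff by blast
      then have "1 \<le> Re (4 * a * fst (f t))" unfolding minus_complex.sel one_complex.sel by linarith
      then show False using complex_Re_le_cmod[of "4 * a * fst (f t)"] small[OF that] by linarith
    qed
  qed
  then show ?thesis unfolding straighten_def
    by (intro holomorphic_on_divide holomorphic_on_mult holomorphic_on_add holomorphic_on_const assms) auto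
qed

text \<open>The threshold \<open>m0\<close> depends on the length \<open>M\<close> and on \<open>\<epsilon>\<close>, but not on \<open>k\<close> nor on the chain.
  This uniformity is what allows all preimages of one point to be treated at once.\<close>

lemma vertical_bound:
  fixes lam M :: real and a \<epsilon> :: complex
  assumes lam: "0 < lam" "lam < 1" and \<epsilon>: "\<epsilon> \<in> quad_basin lam"
  shows "\<exists>m0. \<forall>m\<ge>m0. \<forall>k D p q. \<forall>L\<in>kobayashi_chain_lengths D p q.
      D \<subseteq> attracting_basin (F_map lam a) (0, 0) \<longrightarrow> L \<le> M \<longrightarrow>
      fst ((F_map lam a ^^ k) q) = \<epsilon> \<longrightarrow>
      \<bar>loglog (straighten a ((F_map lam a ^^ (m + k)) p)) -
       loglog (straighten a ((F_map lam a ^^ (m + k)) q))\<bar> \<le> 4 * hyp_const * M"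
proof -
  let ?F = "F_map lam a"
  obtain K where K: "compact K" "K \<subseteq> quad_basin lam" and
    conf: "\<forall>(n::nat) x s f. x n = \<epsilon> \<and>
       (\<forall>i<n. f i holomorphic_on ball 0 1 \<and> f i ` ball 0 1 \<subseteq> quad_basin lam \<and>
              norm (s i) < 1 \<and> f i 0 = x i \<and> f i (s i) = x (Suc i)) \<and>
       (\<Sum>i<n. artanh (norm (s i))) \<le> M \<longrightarrow>
       (\<forall>i<n. \<forall>t. norm t \<le> (1 + norm (s i)) / 2 \<longrightarrow> f i t \<in> K)"
    using horizontal_confinement[OF lam \<epsilon>, of M] by (elim exE conjE) (rule that)
  define r where "r = 1 / (4 * norm a + 1)"
  have r: "r > 0" by (simp add: r_def add_nonneg_pos)
  have rsmall: "norm (4 * a * z) < 1" if "norm z < r" for z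
  proof -
    have "norm (4 * a * z) \<le> (4 * norm a) * r"
      using that by (auto simp: norm_mult intro!: mult_left_mono)
    also have "\<dots> < 1" unfolding r_def by (simp add: divide_less_eq add_nonneg_pos)
    finally show ?thesis .
  qed
  obtain m0 where m0: "\<And>n z. n \<ge> m0 \<Longrightarrow> z \<in> K \<Longrightarrow> norm ((quad lam ^^ n) z) < r"
    by (rule quad_funpow_uniformly_small[OF lam K r]) (rule that)
  show ?thesis
  proof (intro exI[of _ m0] allI impI ballI)
    fix m k D p q L
    assume m: "m \<ge> m0" and D: "D \<subseteq> attracting_basin ?F (0, 0)"
      and L: "L \<in> kobayashi_chain_lengths D p q" "L \<le> M" and q: "fst ((?F ^^ k) q) = \<epsilon>"
    obtain n x g s where x: "x 0 = p" "x n = q" and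
      chain: "\<forall>i<n. holomorphic_disc D (g i) \<and> norm (s i) < 1 \<and> g i 0 = x i \<and> g i (s i) = x (Suc i)" and
      Leq: "L = (\<Sum>i<n. artanh (norm (s i)))"
      using kobayashi_chain_recentre[OF L(1)] by (elim exE conjE) (rule that)
    have g: "holomorphic_disc D (g i)" and s: "norm (s i) < 1" and g0: "g i 0 = x i"
      and gs: "g i (s i) = x (Suc i)" if "i < n" for i
      using chain that by auto
    have ghol: "(\<lambda>t. fst (g i t)) holomorphic_on ball 0 1" "(\<lambda>t. snd (g i t)) holomorphic_on ball 0 1"
      if "i < n" for i
      using g[OF that] by (auto simp: holomorphic_disc_def)
    have gD: "g i t \<in> attracting_basin ?F (0, 0)" if "i < n" "norm t < 1" for i t
      using g[OF that(1)] D that(2) unfolding holomorphic_disc_def by (auto simp: image_subset_iff)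
    have chainB: "(\<lambda>t. fst ((?F ^^ k) (g j t))) holomorphic_on ball 0 1 \<and>
        (\<lambda>t. fst ((?F ^^ k) (g j t))) ` ball 0 1 \<subseteq> quad_basin lam \<and> norm (s j) < 1 \<and>
        fst ((?F ^^ k) (g j 0)) = fst ((?F ^^ k) (x j)) \<and>
        fst ((?F ^^ k) (g j (s j))) = fst ((?F ^^ k) (x (Suc j)))" if j: "j < n" for j
    proof -
      have "fst ((?F ^^ k) (g j t)) \<in> quad_basin lam" if "norm t < 1" for t
        using fst_basin_subset_quad_basin[OF gD[OF j that]]
        by (simp add: fst_F_funpow quad_funpow_in_basin_iff)
      then show ?thesis
        using F_funpow_holomorphic[OF ghol[OF j], of k lam a] s[OF j] g0[OF j] gs[OF j]
        by auto
    qed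
    have inK: "fst ((?F ^^ k) (g i t)) \<in> K" if "i < n" "norm t \<le> (1 + norm (s i)) / 2" for i t
      using conf[rule_format, where x = "\<lambda>j. fst ((?F ^^ k) (x j))" and n = n and s = s
          and f = "\<lambda>i t. fst ((?F ^^ k) (g i t))"] chainB q x(2) Leq L(2) that by auto
    have step: "\<bar>loglog (straighten a ((?F ^^ (m + k)) (x (Suc i)))) -
        loglog (straighten a ((?F ^^ (m + k)) (x i)))\<bar> \<le> 4 * hyp_const * artanh (norm (s i))"
      if i: "i < n" for i
    proof -
      define G where "G = (\<lambda>t. straighten a ((?F ^^ (m + k)) (g i t)))"
      \<comment> \<open>Discs of half the maximal radius stay in the range of parameters covered by \<open>inK\<close>.\<close>
      have half: "norm t \<le> (1 + norm (s i)) / 2" "norm t < 1"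
        if y: "0 \<le> y" "y \<le> 1" and t: "t \<in> ball (of_real y * s i) (1 / 2 * (1 - y * norm (s i)))" for y t
      proof -
        have "norm t \<le> norm (of_real y * s i) + norm (t - of_real y * s i)"
          using norm_triangle_ineq[of "of_real y * s i" "t - of_real y * s i"] by simp
        also have "\<dots> \<le> y * norm (s i) + 1 / 2 * (1 - y * norm (s i))"
          using t y by (auto simp: dist_norm norm_mult norm_minus_commute)
        finally have "norm t \<le> (1 + y * norm (s i)) / 2" by argo
        also have "y * norm (s i) \<le> 1 * norm (s i)" using y by (intro mult_right_mono) auto
        finally show "norm t \<le> (1 + norm (s i)) / 2" by simp
        then show "norm t < 1" using s[OF i] by simp
      qed
      have small: "norm (4 * a * fst ((?F ^^ (m + k)) (g i t))) < 1"
        if "norm t \<le> (1 + norm (s i)) / 2" for t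
        using rsmall m0[OF m inK[OF i that]] by (simp add: fst_F_funpow funpow_add)
      have "\<bar>loglog (G (s i)) - loglog (G 0)\<bar> \<le> 2 * hyp_const / (1 / 2) * artanh (norm (s i))"
      proof (rule loglog_segment_bound[OF s[OF i]])
        fix y :: real assume y: "0 \<le> y" "y \<le> 1"
        have sub: "ball (of_real y * s i) (1 / 2 * (1 - y * norm (s i))) \<subseteq> ball 0 1"
          using half(2)[OF y] by auto
        have "(\<lambda>t. fst ((?F ^^ (m + k)) (g i t))) holomorphic_on ball (of_real y * s i) (1 / 2 * (1 - y * norm (s i)))"
             "(\<lambda>t. snd ((?F ^^ (m + k)) (g i t))) holomorphic_on ball (of_real y * s i) (1 / 2 * (1 - y * norm (s i)))"
          using F_funpow_holomorphic[OF ghol[OF i]] holomorphic_on_subset[OF _ sub] by blast+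
        then show "G holomorphic_on ball (of_real y * s i) (1 / 2 * (1 - y * norm (s i)))"
          unfolding G_def by (rule straighten_holomorphic) (use small half(1)[OF y] in blast)
        fix t assume t: "t \<in> ball (of_real y * s i) (1 / 2 * (1 - y * norm (s i)))"
        have "snd ((?F ^^ j) (g i t)) \<noteq> 0" for j
          using F_orbit_snd_nonzero_on_basin[OF gD[OF i half(2)[OF y t]]] .
        from this[of "m + k"] this[of "Suc (m + k)"]
        show "G t \<noteq> 0 \<and> G t \<noteq> 1"
          using straighten_ne_1 straighten_eq_0_iff unfolding G_def by auto
      qed auto
      then show ?thesis by (simp add: G_def g0[OF i] gs[OF i])
    qed
    have "\<bar>loglog (straighten a ((?F ^^ (m + k)) (x 0))) -
        loglog (straighten a ((?F ^^ (m + k)) (x n)))\<bar> \<le> 4 * hyp_const * (\<Sum>i<n. artanh (norm (s i)))"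
      by (rule chain_potential_bound[where y = "\<lambda>i. loglog (straighten a ((?F ^^ (m + k)) (x i)))"])
         (use step hyp_const_pos s in \<open>auto intro: artanh_nonneg\<close>)
    also have "\<dots> \<le> 4 * hyp_const * M"
      using L(2) hyp_const_pos unfolding Leq by (intro mult_left_mono) auto
    finally show "\<bar>loglog (straighten a ((?F ^^ (m + k)) p)) -
       loglog (straighten a ((?F ^^ (m + k)) q))\<bar> \<le> 4 * hyp_const * M"
      using x by simp
  qed
qed

section \<open>Points far from all preimages\<close>

theorem theorem5p9:
  fixes lam :: real and a :: complex
  assumes "0 < lam" and "lam < 1"
  shows "\<exists>\<epsilon>\<^sub>0 > 0. \<forall>\<epsilon>::real. 0 < \<epsilon> \<and> \<epsilon> < \<epsilon>\<^sub>0 \<longrightarrow>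
    (\<forall>D \<in> components (attracting_basin (F_map lam a) (0, 0)).
      \<forall>C::real. C > 0 \<longrightarrow>
        (\<exists>p \<in> D. \<forall>q \<in> preimages (F_map lam a) (of_real \<epsilon>, of_real \<epsilon>) \<inter> D.
          kobayashi_dist D p q \<ge> C))"
proof -
  note lam = assms
  let ?F = "F_map lam a"
  define R where "R = 16 * (1 + norm a)"
  have R: "R \<ge> 16 * (1 + norm a)" by (simp add: R_def)
  have R0: "R > 0" by (simp add: R_def add_pos_nonneg)
  have petal_real: "of_real t \<in> petal R" if "0 < t" "t < 1 / R" for t :: real
  proof -
    have "Re (1 / of_real t) = 1 / t" by (simp add: Re_divide_of_real)
    then show ?thesis using that R0 by (simp add: mem_petal_iff field_simps)
  qed
  show ?thesis
  proof (intro exI[of _ "min ((1 - lam) / 2) (1 / R)"] conjI allI impI ballI)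
    show "0 < min ((1 - lam) / 2) (1 / R)" using lam R0 by simp
    fix \<epsilon> :: real and D and C :: real
    assume \<epsilon>: "0 < \<epsilon> \<and> \<epsilon> < min ((1 - lam) / 2) (1 / R)"
      and D: "D \<in> components (attracting_basin ?F (0, 0))" and C: "C > 0"
    define E where "E = (of_real \<epsilon> :: complex)"
    have Ez: "norm E < (1 - lam) / 2" using \<epsilon> by (simp add: E_def)
    have Ew: "E \<in> petal R" using \<epsilon> petal_real unfolding E_def by simp
    have EB: "E \<in> quad_basin lam" by (rule small_in_quad_basin[OF lam Ez])
    have Dsub: "D \<subseteq> attracting_basin ?F (0, 0)" by (rule in_components_subset[OF D])
    have Dopen: "open D" by (rule open_components[OF open_attracting_basin D])
    have Dconn: "connected D" by (rule in_components_connected[OF D])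
    show "\<exists>p\<in>D. \<forall>q\<in>preimages ?F (of_real \<epsilon>, of_real \<epsilon>) \<inter> D. kobayashi_dist D p q \<ge> C"
    proof (cases "preimages ?F (E, E) \<inter> D = {}")
      case True
      then show ?thesis using in_components_nonempty[OF D] unfolding E_def by blast
    next
      case False
      then obtain q0 k0 where q0: "q0 \<in> D" "(?F ^^ k0) q0 = (E, E)" unfolding preimages_def by blast
      obtain m0 where m0: "\<forall>m\<ge>m0. \<forall>k D p q. \<forall>L\<in>kobayashi_chain_lengths D p q.
          D \<subseteq> attracting_basin ?F (0, 0) \<longrightarrow> L \<le> C \<longrightarrow> fst ((?F ^^ k) q) = E \<longrightarrow>
          \<bar>loglog (straighten a ((?F ^^ (m + k)) p)) -
           loglog (straighten a ((?F ^^ (m + k)) q))\<bar> \<le> 4 * hyp_const * C"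
        using vertical_bound[OF lam EB, of a C] by (elim exE) (rule that)
      \<comment> \<open>\<open>m \<ge> k0\<close> guarantees that \<open>F\<^sup>m\<^sup>+\<^sup>k p\<close> is a forward iterate of \<open>F\<^sup>k\<^sup>0 p\<close>, which will lie in the petal.\<close>
      define m where "m = max m0 k0"
      \<comment> \<open>A chain of length at most \<open>C\<close> would force \<open>\<bar>loglog\<bar> \<le> M\<close> at the pushed forward starting point,
        hence modulus at least \<open>\<eta>\<close>; the depth \<open>\<delta>\<close> in the petal is chosen to violate this.\<close>
      define M where "M = \<bar>loglog (straighten a ((?F ^^ m) (E, E)))\<bar> + 4 * hyp_const * C"
      define \<eta> where "\<eta> = exp (- sinh M)"
      define \<delta> where "\<delta> = min \<epsilon> (\<eta> / (2 * (2 + 2 * norm a)))"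
      have na: "2 + 2 * norm a > 0" by (simp add: add_pos_nonneg)
      have \<eta>: "\<eta> > 0" by (simp add: \<eta>_def)
      have \<delta>: "0 < \<delta>" "\<delta> \<le> \<epsilon>" "(2 + 2 * norm a) * \<delta> < \<eta>"
      proof -
        show "0 < \<delta>" "\<delta> \<le> \<epsilon>" using \<epsilon> \<eta> na by (simp_all add: \<delta>_def)
        have "\<delta> \<le> \<eta> / (2 * (2 + 2 * norm a))" by (simp add: \<delta>_def)
        then have "2 * ((2 + 2 * norm a) * \<delta>) \<le> \<eta>"
          using na by (simp only: pos_le_divide_eq mult_pos_pos zero_less_numeral mult_ac)
        then show "(2 + 2 * norm a) * \<delta> < \<eta>" using \<eta> by linarith
      qed
      have \<delta>w: "of_real \<delta> \<in> petal R" using \<delta> \<epsilon> by (intro petal_real) auto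
      obtain p where p: "p \<in> D" "(?F ^^ k0) p = (E, of_real \<delta>)"
        using component_meets_petal_fibre[OF lam R D q0 Ez Ew \<delta>w] by blast
      have "C \<le> kobayashi_dist D p q" if q: "q \<in> preimages ?F (E, E) \<inter> D" for q
      proof (rule kobayashi_dist_ge[OF Dopen Dconn p(1)])
        show "q \<in> D" using q by blast
        fix L assume L: "L \<in> kobayashi_chain_lengths D p q"
        show "C \<le> L"
        proof (rule ccontr)
          assume "\<not> C \<le> L"
          obtain k where k: "(?F ^^ k) q = (E, E)" using q unfolding preimages_def by blast
          define P where "P = (?F ^^ (m + k)) p"
          have "\<bar>loglog (straighten a P) - loglog (straighten a ((?F ^^ (m + k)) q))\<bar> \<le> 4 * hyp_const * C"
            unfolding P_def
            by (rule m0[rule_format, OF _ L Dsub]) (use \<open>\<not> C \<le> L\<close> k in \<open>auto simp: m_def\<close>)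
          then have "\<bar>loglog (straighten a P)\<bar> \<le> M"
            by (simp add: M_def funpow_add k)
          moreover have "straighten a P \<noteq> 0"
            using F_orbit_snd_nonzero_on_basin[of p lam a "m + k"] p(1) Dsub
            by (auto simp: straighten_eq_0_iff P_def)
          ultimately have "\<eta> \<le> norm (straighten a P)"
            unfolding \<eta>_def by (rule norm_ge_of_loglog)
          define j where "j = m + k - k0"
          have "m + k = j + k0" by (simp add: j_def m_def)
          then have Peq: "P = (?F ^^ j) (E, of_real \<delta>)" by (simp add: P_def funpow_add p(2))
          have "norm (fst P) \<le> 1"
            using quad_funpow_norm_le[OF lam Ez, of j] Ez lam by (simp add: Peq fst_F_funpow)
          then have "norm (straighten a P) \<le> (2 + 2 * norm a) * norm (snd P)"
            by (rule straighten_norm_le)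
          also have "norm (snd P) \<le> \<delta>"
          proof -
            have "norm (snd P) \<le> 1 / (Re (1 / of_real \<delta>) + real j / 2)"
              unfolding Peq by (rule petal_orbit_norm[OF lam R \<delta>w Ez])
            also have "\<dots> \<le> 1 / Re (1 / of_real \<delta>)"
            proof (rule divide_left_mono)
              have "0 < 1 / \<delta>" "0 \<le> real j / 2" using \<delta>(1) by auto
              then show "0 < (Re (1 / of_real \<delta>) + real j / 2) * Re (1 / of_real \<delta>)"
                by (intro mult_pos_pos) (auto simp: Re_divide_of_real intro: add_pos_nonneg)
            qed auto
            also have "\<dots> = \<delta>" using \<delta>(1) by simp
            finally show ?thesis .
          qed
          then have "(2 + 2 * norm a) * norm (snd P) \<le> (2 + 2 * norm a) * \<delta>"
            using na by (intro mult_left_mono) auto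
          finally show False using \<delta>(3) \<open>\<eta> \<le> norm (straighten a P)\<close> by linarith
        qed
      qed
      then show ?thesis using p(1) unfolding E_def by blast
    qed
  qed
qed

end
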